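(* The group $GL(2,\mathbb R)$ satisfies property (ICP). More precisely, let $A\in GL(2,\mathbb R)$, $A$ not involutive (i.e. $A^2\neq\mathrm{Id}$), and let $\gamma$ be an invariant curve of class $C^\infty$ for $A$ passing through $0$. Then $\gamma$ is real-analytic (in fact real-algebraic).
   Context: $\mathrm{Diff}^\omega(\mathbb R^2,0)$ is the group of germs at $0$ of real-analytic maps of $\mathbb R^2$ fixing $0$ with non-zero Jacobian determinant at $0$; $GL(2,\mathbb R)$ is regarded as a subgroup of it. A curve of class $C^\infty$ around (passing through) $0$ is a closed $1$-dimensional $C^\infty$ submanifold $\lambda$ of an open neighborhood of $0$ in $\mathbb R^2$ such that $0\in\lambda$; it is an invariant curve for a germ $g$ if $g(q)\in\lambda$ for any $q\in\lambda$ close enough to $0$. A subgroup $\mathcal G\leq\mathrm{Diff}^\omega(\mathbb R^2,0)$ satisfies (ICP), the invariant curve property, if for every $g\in\mathcal G$ with $g\circ g\neq\mathrm{Id}$ and for any curve $\lambda$ of class $C^\infty$ around $0$ which is invariant under $g$, $\lambda\setminus\{0\}$ is real-analytic, that is, for any $p\in\lambda$, $p\neq 0$, there is a neighborhood $U$ of $p$ in $\mathbb R^2$ such that $\lambda\cap U$ is real-analytic.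
   Formalization: Curves are read as germs at 0: analyticity (also in (ICP)) and algebraicity are claimed only in some neighborhood of 0, since invariance near 0 does not constrain the curve further away (A = 2 Id, a line near 0 continued by a non-analytic smooth arc). *)

theory Defs
  imports "HOL-Analysis.Analysis" "HOL-Algebra.Group"
begin

text \<open>A map is of class \<open>C\<^sup>k\<^sup>+\<^sup>1\<close> on an open set iff it is differentiable there
  and each of its directional derivatives is of class \<open>C\<^sup>k\<close>.\<close>

primrec Ck_on :: "nat \<Rightarrow> (real^2 \<Rightarrow> real^2) \<Rightarrow> (real^2) set \<Rightarrow> bool" where
  "Ck_on 0 f U \<longleftrightarrow> continuous_on U f"
| "Ck_on (Suc k) f U \<longleftrightarrow>
     (\<exists>f'. (\<forall>x\<in>U. (f has_derivative f' x) (at x)) \<and> (\<forall>v. Ck_on k (\<lambda>x. f' x v) U))"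

definition smooth_on :: "(real^2 \<Rightarrow> real^2) \<Rightarrow> (real^2) set \<Rightarrow> bool" where
  "smooth_on f U \<longleftrightarrow> (\<forall>k. Ck_on k f U)"

definition real_analytic_on :: "(real^2 \<Rightarrow> real^2) \<Rightarrow> (real^2) set \<Rightarrow> bool" where
  "real_analytic_on f U \<longleftrightarrow>
     (\<forall>p\<in>U. \<exists>(a :: nat \<Rightarrow> nat \<Rightarrow> real^2) r. r > 0 \<and>
        (\<forall>x\<in>ball p r.
           ((\<lambda>(i, j). ((x$1 - p$1) ^ i * (x$2 - p$2) ^ j) *\<^sub>R a i j) has_sum f x) UNIV))"

text \<open>The regularity class \<open>C\<close> below is \<^const>\<open>smooth_on\<close> or \<^const>\<open>real_analytic_on\<close>.\<close>

definition diffeo_on ::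
  "((real^2 \<Rightarrow> real^2) \<Rightarrow> (real^2) set \<Rightarrow> bool) \<Rightarrow> (real^2) set \<Rightarrow> (real^2 \<Rightarrow> real^2) \<Rightarrow> bool" where
  "diffeo_on C U \<phi> \<longleftrightarrow>
     open U \<and> open (\<phi> ` U) \<and> C \<phi> U \<and> (\<exists>\<psi>. C \<psi> (\<phi> ` U) \<and> (\<forall>x\<in>U. \<psi> (\<phi> x) = x))"

text \<open>\<open>S\<close> is a closed one-dimensional submanifold of class \<open>C\<close> of the open set \<open>V\<close>:
  around each of its points some chart of the plane straightens it to the first axis.\<close>

definition closed_curve_in ::
  "((real^2 \<Rightarrow> real^2) \<Rightarrow> (real^2) set \<Rightarrow> bool) \<Rightarrow> (real^2) set \<Rightarrow> (real^2) set \<Rightarrow> bool" where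
  "closed_curve_in C V S \<longleftrightarrow>
     open V \<and> closedin (top_of_set V) S \<and>
     (\<forall>p\<in>S. \<exists>U \<phi>. p \<in> U \<and> U \<subseteq> V \<and> diffeo_on C U \<phi> \<and>
        \<phi> ` (S \<inter> U) = \<phi> ` U \<inter> {y. y$2 = 0})"

definition smooth_curve_around_0 :: "(real^2) set \<Rightarrow> bool" where
  "smooth_curve_around_0 S \<longleftrightarrow> 0 \<in> S \<and> (\<exists>V. closed_curve_in smooth_on V S)"

definition real_algebraic_in :: "(real^2) set \<Rightarrow> (real^2) set \<Rightarrow> bool" where
  "real_algebraic_in V S \<longleftrightarrow>
     (\<exists>P. real_polynomial_function P \<and> (\<exists>x. P x \<noteq> 0) \<and> S = {x\<in>V. P x = 0})"

definition germ :: "(real^2 \<Rightarrow> real^2) \<Rightarrow> (real^2 \<Rightarrow> real^2) set" where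
  "germ f = {h. \<forall>\<^sub>F x in nhds 0. h x = f x}"

text \<open>Composition of germs via representatives; it depends only on the two germs because the
  maps considered are continuous and fix the origin.\<close>

definition germ_comp ::
  "(real^2 \<Rightarrow> real^2) set \<Rightarrow> (real^2 \<Rightarrow> real^2) set \<Rightarrow> (real^2 \<Rightarrow> real^2) set" where
  "germ_comp a b = {h. \<exists>f\<in>a. \<exists>g\<in>b. \<forall>\<^sub>F x in nhds 0. h x = f (g x)}"

definition Diff_omega :: "(real^2 \<Rightarrow> real^2) set monoid" where
  "Diff_omega =
     \<lparr>carrier = {germ f | f. f 0 = 0 \<and> (\<exists>U. open U \<and> 0 \<in> U \<and> real_analytic_on f U) \<and>
                            det (jacobian f (at 0)) \<noteq> 0},
      monoid.mult = germ_comp,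
      one = germ id\<rparr>"

definition GL2 :: "(real^2 \<Rightarrow> real^2) set set" where
  "GL2 = {germ ((*v) A) | A :: real^2^2. invertible A}"

definition invariant_curve :: "(real^2 \<Rightarrow> real^2) set \<Rightarrow> (real^2) set \<Rightarrow> bool" where
  "invariant_curve g S \<longleftrightarrow> (\<exists>f\<in>g. \<forall>\<^sub>F q in nhds 0. q \<in> S \<longrightarrow> f q \<in> S)"

text \<open>Invariance under a germ constrains a curve only near the origin (a curve which is a line near
  the origin and arbitrary further away is invariant under homotheties), so curves are understood
  here as germs at the origin: analyticity is required at the points
  of \<open>S - {0}\<close> in some neighbourhood \<open>W\<close> of the origin.\<close>

definition ICP :: "(real^2 \<Rightarrow> real^2) set set \<Rightarrow> bool" where
  "ICP G \<longleftrightarrow> subgroup G Diff_omega \<and>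
     (\<forall>g\<in>G. g \<otimes>\<^bsub>Diff_omega\<^esub> g \<noteq> \<one>\<^bsub>Diff_omega\<^esub> \<longrightarrow>
       (\<forall>S. smooth_curve_around_0 S \<and> invariant_curve g S \<longrightarrow>
         (\<exists>W. open W \<and> 0 \<in> W \<and>
           (\<forall>p \<in> S \<inter> W - {0}. \<exists>U. p \<in> U \<and> closed_curve_in real_analytic_on U (S \<inter> U)))))"

end

theory Submission
  imports Defs "HOL-Computational_Algebra.Polynomial"
begin

text \<open>Let \<open>v\<close> be tangent to the invariant curve at \<open>0\<close>. Then \<open>v\<close> is an eigenvector of \<open>A\<close>, so there are
  linear coordinates \<open>(\<xi>, \<eta>)\<close> in which \<open>A\<close> is \<open>(\<xi>, \<eta>) \<mapsto> (a \<xi> + b \<eta>, d \<eta>)\<close> and the curve is tangent to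
  \<open>\<eta> = 0\<close>; a shear yields \<open>b = 0\<close> when \<open>a \<noteq> d\<close>. By smoothness, along the curve either
  \<open>\<eta> = O(\<xi>\<^sup>n)\<close> for all \<open>n\<close>, or \<open>\<eta> = \<alpha> \<xi>\<^sup>k + O(\<xi>\<^sup>k\<^sup>+\<^sup>1)\<close> with \<open>\<alpha> \<noteq> 0\<close>, \<open>k \<ge> 2\<close>.
  If \<open>\<bar>a\<bar> < 1\<close>, iterating \<open>A\<close> shows that a function \<open>h\<close> with \<open>h \<circ> A = d h\<close> vanishes on the curve as soon as
  it is \<open>O(\<xi>\<^sup>m)\<close> there with \<open>\<bar>a\<bar>\<^sup>m < \<bar>d\<bar>\<close>. Applied to \<open>h = \<eta>\<close> this settles all cases except
  \<open>d = a\<^sup>k\<close>, where it is applied to \<open>h = \<eta> - \<alpha> \<xi>\<^sup>k\<close>. The case \<open>\<bar>a\<bar> > 1\<close> reduces to this one by passing to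
  the inverse of \<open>A\<close>, and for \<open>\<bar>a\<bar> = 1\<close> the curve is the line \<open>\<eta> = 0\<close>: either \<open>\<bar>d\<bar> \<noteq> 1\<close> and the same
  iteration applies, or the square of \<open>A\<close> is a non-trivial shear. So the curve is always \<open>\<eta> = \<alpha> \<xi>\<^sup>k\<close> near \<open>0\<close>.\<close>

section \<open>Eigenfunctions on sets invariant near a fixed point\<close>

text \<open>On \<open>S\<close> near 0, \<open>\<xi>\<close> controls the distance to 0 and
  \<open>A\<close> does not increase \<bar>\<xi>\<bar>, so orbits starting in a small sublevel set
  stay there. This turns hypotheses valid only near 0 into ones valid along whole orbits.\<close>

lemma trapping_region:
  fixes A :: "'a::real_normed_vector \<Rightarrow> 'a" and \<xi> :: "'a \<Rightarrow> real"
  assumes A: "(A \<longlongrightarrow> 0) (nhds 0)" and \<xi>: "(\<xi> \<longlongrightarrow> 0) (nhds 0)"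
    and inv: "\<forall>\<^sub>F p in nhds 0. p \<in> S \<longrightarrow> A p \<in> S"
    and comp: "\<forall>\<^sub>F p in nhds 0. p \<in> S \<longrightarrow> norm p \<le> K * \<bar>\<xi> p\<bar>"
    and dec: "\<forall>\<^sub>F p in nhds 0. p \<in> S \<longrightarrow> \<bar>\<xi> (A p)\<bar> \<le> \<bar>\<xi> p\<bar>"
    and Q: "\<forall>\<^sub>F p in nhds 0. p \<in> S \<longrightarrow> Q p"
  obtains D where "\<forall>\<^sub>F p in nhds 0. p \<in> S \<longrightarrow> p \<in> D" "\<And>p. p \<in> D \<Longrightarrow> A p \<in> D" "\<And>p. p \<in> D \<Longrightarrow> Q p"
proof -
  have "\<forall>\<^sub>F p in nhds 0. p \<in> S \<longrightarrow> A p \<in> S \<and> norm p \<le> K * \<bar>\<xi> p\<bar> \<and> \<bar>\<xi> (A p)\<bar> \<le> \<bar>\<xi> p\<bar> \<and> Q p"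
    using inv comp dec Q by eventually_elim auto
  then obtain r where r: "r > 0" and *: "\<And>p. norm p < r \<Longrightarrow> p \<in> S \<Longrightarrow>
      A p \<in> S \<and> norm p \<le> K * \<bar>\<xi> p\<bar> \<and> \<bar>\<xi> (A p)\<bar> \<le> \<bar>\<xi> p\<bar> \<and> Q p"
    by (auto simp: eventually_nhds_metric)
  have "\<forall>\<^sub>F p in nhds 0. norm (A p) < r"
    using A r by (intro order_tendstoD(2)[where y="0::real"] tendsto_norm_zero) auto
  then obtain s where s: "s > 0" and **: "\<And>p. norm p < s \<Longrightarrow> norm (A p) < r"
    by (auto simp: eventually_nhds_metric)
  \<comment> \<open>If \<bar>\<xi> p\<bar> is below this bound, comparability gives
    \<open>norm p < s\<close>, so \<open>A p\<close> lies again in the ball of radius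
    \<open>r\<close>. The summand 1 admits every real \<open>K\<close>.\<close>
  define \<rho> where "\<rho> = s / (\<bar>K\<bar> + 1)"
  have \<rho>: "\<rho> > 0" using s by (simp add: \<rho>_def add_nonneg_pos)
  \<comment> \<open>The ball is where the local hypotheses apply; the bound on \<bar>\<xi>\<bar> is
    what iteration preserves.\<close>
  define D where "D = {p \<in> S. norm p < r \<and> \<bar>\<xi> p\<bar> < \<rho>}"
  show ?thesis
  proof
    have "\<forall>\<^sub>F p in nhds 0. \<bar>\<xi> p\<bar> < \<rho>"
      using \<xi> \<rho> by (intro order_tendstoD(2)[where y="0::real"] tendsto_rabs_zero) auto
    moreover have "\<forall>\<^sub>F p in nhds (0::'a). norm p < r"
      using r by (auto simp: eventually_nhds_metric)
    ultimately show "\<forall>\<^sub>F p in nhds 0. p \<in> S \<longrightarrow> p \<in> D"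
      by eventually_elim (auto simp: D_def)
  next
    fix p assume p: "p \<in> D"
    then have "norm p \<le> K * \<bar>\<xi> p\<bar>" using * by (auto simp: D_def)
    also have "\<dots> \<le> (\<bar>K\<bar> + 1) * \<bar>\<xi> p\<bar>" by (intro mult_right_mono) auto
    also have "\<dots> < (\<bar>K\<bar> + 1) * \<rho>" using p by (intro mult_strict_left_mono) (auto simp: D_def)
    also have "\<dots> = s" by (simp add: \<rho>_def)
    finally have "norm (A p) < r" using ** by auto
    then show "A p \<in> D" using p * by (force simp: D_def)
    show "Q p" using p * by (auto simp: D_def)
  qed
qed

text \<open>After \<open>n\<close> iterations \<open>h\<close> is multiplied by
  \<open>d ^ n\<close>, while its bound shrinks by \<open>(c ^ m) ^ n\<close>; hence
  \<open>h p\<close> is at most a constant times the n-th power of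
  \<open>c ^ m / \<bar>d\<bar> < 1\<close>. Admitting \<open>c = 1\<close> covers maps that preserve
  \<bar>\<xi>\<bar> when \<open>\<bar>d\<bar> > 1\<close>.\<close>

lemma contracted_eigenfunction_vanishes:
  fixes A :: "'a::real_normed_vector \<Rightarrow> 'a" and \<xi> h :: "'a \<Rightarrow> real"
  assumes A: "(A \<longlongrightarrow> 0) (nhds 0)" and \<xi>: "(\<xi> \<longlongrightarrow> 0) (nhds 0)"
    and inv: "\<forall>\<^sub>F p in nhds 0. p \<in> S \<longrightarrow> A p \<in> S"
    and comp: "\<forall>\<^sub>F p in nhds 0. p \<in> S \<longrightarrow> norm p \<le> K * \<bar>\<xi> p\<bar>"
    and c: "0 \<le> c" "c \<le> 1"
    and con: "\<forall>\<^sub>F p in nhds 0. p \<in> S \<longrightarrow> \<bar>\<xi> (A p)\<bar> \<le> c * \<bar>\<xi> p\<bar>"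
    and h: "\<forall>\<^sub>F p in nhds 0. p \<in> S \<longrightarrow> \<bar>h p\<bar> \<le> C * \<bar>\<xi> p\<bar> ^ m"
    and hA: "\<And>p. h (A p) = d * h p" and cd: "c ^ m < \<bar>d\<bar>"
  shows "\<forall>\<^sub>F p in nhds 0. p \<in> S \<longrightarrow> h p = 0"
proof -
  have dec: "\<forall>\<^sub>F p in nhds 0. p \<in> S \<longrightarrow> \<bar>\<xi> (A p)\<bar> \<le> \<bar>\<xi> p\<bar>"
    using con
  proof eventually_elim
    case (elim p)
    have "c * \<bar>\<xi> p\<bar> \<le> \<bar>\<xi> p\<bar>" using c by (simp add: mult_left_le_one_le)
    then show ?case using elim by auto
  qed
  have Q: "\<forall>\<^sub>F p in nhds 0. p \<in> S \<longrightarrow> \<bar>\<xi> (A p)\<bar> \<le> c * \<bar>\<xi> p\<bar> \<and> \<bar>h p\<bar> \<le> C * \<bar>\<xi> p\<bar> ^ m"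
    using con h by eventually_elim auto
  obtain D where D: "\<forall>\<^sub>F p in nhds 0. p \<in> S \<longrightarrow> p \<in> D" "\<And>p. p \<in> D \<Longrightarrow> A p \<in> D"
    "\<And>p. p \<in> D \<Longrightarrow> \<bar>\<xi> (A p)\<bar> \<le> c * \<bar>\<xi> p\<bar> \<and> \<bar>h p\<bar> \<le> C * \<bar>\<xi> p\<bar> ^ m"
    using trapping_region[OF A \<xi> inv comp dec Q] by blast
  have "h p = 0" if p: "p \<in> D" for p
  proof -
    have it: "(A ^^ n) p \<in> D \<and> \<bar>\<xi> ((A ^^ n) p)\<bar> \<le> c ^ n * \<bar>\<xi> p\<bar> \<and> h ((A ^^ n) p) = d ^ n * h p" for n
    proof (induction n)
      case (Suc n)
      have "\<bar>\<xi> (A ((A ^^ n) p))\<bar> \<le> c * \<bar>\<xi> ((A ^^ n) p)\<bar>" using D(3) Suc by auto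
      also have "\<dots> \<le> c * (c ^ n * \<bar>\<xi> p\<bar>)" using Suc c by (intro mult_left_mono) auto
      finally show ?case using Suc D(2) hA by (auto simp: mult.assoc)
    qed (use p in auto)
    define q where "q = c ^ m / \<bar>d\<bar>"
    have d0: "\<bar>d\<bar> > 0" using cd c by (smt (verit) zero_le_power)
    have q: "0 \<le> q" "q < 1" using cd c d0 by (auto simp: q_def)
    have bd: "\<bar>h p\<bar> \<le> \<bar>C\<bar> * \<bar>\<xi> p\<bar> ^ m * q ^ n" for n
    proof -
      have "\<bar>d\<bar> ^ n * \<bar>h p\<bar> = \<bar>h ((A ^^ n) p)\<bar>" using it[of n] by (simp add: abs_mult power_abs)
      also have "\<dots> \<le> C * \<bar>\<xi> ((A ^^ n) p)\<bar> ^ m" using D(3) it by blast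
      also have "\<dots> \<le> \<bar>C\<bar> * \<bar>\<xi> ((A ^^ n) p)\<bar> ^ m" by (intro mult_right_mono) auto
      also have "\<dots> \<le> \<bar>C\<bar> * (c ^ n * \<bar>\<xi> p\<bar>) ^ m" using it[of n] by (intro mult_left_mono power_mono) auto
      also have "\<dots> = \<bar>d\<bar> ^ n * (\<bar>C\<bar> * \<bar>\<xi> p\<bar> ^ m * q ^ n)"
        using d0 by (simp add: q_def power_mult_distrib power_divide field_simps flip: power_mult)
      finally show ?thesis using d0 by simp
    qed
    have "(\<lambda>n. \<bar>C\<bar> * \<bar>\<xi> p\<bar> ^ m * q ^ n) \<longlonglongrightarrow> \<bar>C\<bar> * \<bar>\<xi> p\<bar> ^ m * 0"
      using q by (intro tendsto_mult tendsto_const LIMSEQ_power_zero) auto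
    then have "\<bar>h p\<bar> \<le> \<bar>C\<bar> * \<bar>\<xi> p\<bar> ^ m * 0"
      by (rule LIMSEQ_le_const) (use bd in auto)
    then show ?thesis by simp
  qed
  then show ?thesis using D(1) by (auto elim: eventually_mono)
qed

text \<open>A shear preserves \<open>\<eta>\<close> and moves \<open>\<xi>\<close> by steps of constant length \<open>\<bar>b * \<eta> p\<bar>\<close>; on the side where
  it moves towards \<open>\<xi> = 0\<close>, tangency prevents these infinitely many steps from crossing \<open>0\<close>.\<close>

lemma shear_towards_axis:
  fixes A :: "'a::real_normed_vector \<Rightarrow> 'a" and \<xi> \<eta> :: "'a \<Rightarrow> real"
  assumes A: "(A \<longlongrightarrow> 0) (nhds 0)" and \<xi>: "(\<xi> \<longlongrightarrow> 0) (nhds 0)"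
    and inv: "\<forall>\<^sub>F p in nhds 0. p \<in> S \<longrightarrow> A p \<in> S"
    and comp: "\<forall>\<^sub>F p in nhds 0. p \<in> S \<longrightarrow> norm p \<le> K * \<bar>\<xi> p\<bar>"
    and tan: "\<forall>\<^sub>F p in nhds 0. p \<in> S \<longrightarrow> \<bar>\<eta> p\<bar> \<le> M * \<bar>\<xi> p\<bar> ^ 2"
    and \<eta>A: "\<And>p. \<eta> (A p) = \<eta> p" and \<xi>A: "\<And>p. \<xi> (A p) = \<xi> p + b * \<eta> p" and b: "b \<noteq> 0"
  shows "\<forall>\<^sub>F p in nhds 0. p \<in> S \<and> b * \<eta> p * \<xi> p \<le> 0 \<longrightarrow> \<eta> p = 0"
proof -
  \<comment> \<open>\<open>b * \<eta> p\<close> is the displacement of \<open>\<xi>\<close> under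
    \<open>A\<close>; \<open>T\<close> collects the points of \<open>S\<close> where it does not
    have the sign of \<open>\<xi> p\<close>.\<close>
  define T where "T = {p \<in> S. b * \<eta> p * \<xi> p \<le> 0}"
  \<comment> \<open>Where \<bar>\<xi> p\<bar> < e, tangency makes the displacement at most
    \<bar>\<xi> p\<bar>, so no step overshoots 0.\<close>
  define e where "e = 1 / (\<bar>b\<bar> * \<bar>M\<bar> + 1)"
  have e: "e > 0" by (simp add: e_def add_nonneg_pos)
  have small: "\<forall>\<^sub>F p in nhds 0. \<bar>\<xi> p\<bar> < e"
    using \<xi> e by (intro order_tendstoD(2)[where y="0::real"] tendsto_rabs_zero) auto
  have step: "\<forall>\<^sub>F p in nhds 0. p \<in> T \<longrightarrow> \<bar>b * \<eta> p\<bar> \<le> \<bar>\<xi> p\<bar>"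
    using tan small
  proof eventually_elim
    case (elim p)
    show ?case
    proof
      assume "p \<in> T"
      then have "\<bar>\<eta> p\<bar> \<le> M * \<bar>\<xi> p\<bar> ^ 2" using elim by (auto simp: T_def)
      also have "\<dots> \<le> \<bar>M\<bar> * \<bar>\<xi> p\<bar> ^ 2" by (intro mult_right_mono) auto
      finally have "\<bar>b * \<eta> p\<bar> \<le> (\<bar>b\<bar> * \<bar>M\<bar> * \<bar>\<xi> p\<bar>) * \<bar>\<xi> p\<bar>"
        by (simp add: abs_mult power2_eq_square mult.assoc mult_left_mono)
      also have "\<bar>b\<bar> * \<bar>M\<bar> * \<bar>\<xi> p\<bar> \<le> (\<bar>b\<bar> * \<bar>M\<bar> + 1) * e"
        using elim e by (intro mult_mono) auto
      also have "\<dots> = 1" by (simp add: e_def add_nonneg_eq_0_iff)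
      finally show "\<bar>b * \<eta> p\<bar> \<le> \<bar>\<xi> p\<bar>" by (simp add: mult_right_mono)
    qed
  qed
  \<comment> \<open>A step \<open>y\<close> against the sign of \<open>x\<close> and no longer than
    \<bar>x\<bar> shortens \<bar>x\<bar> by exactly \<bar>y\<bar>, and the next step is again
    directed suitably.\<close>
  have key: "\<bar>x + y\<bar> = \<bar>x\<bar> - \<bar>y\<bar> \<and> y * (x + y) \<le> 0" if "y * x \<le> 0" "\<bar>y\<bar> \<le> \<bar>x\<bar>" for x y :: real
  proof (cases "y = 0")
    case False
    with that have "(y > 0 \<and> x \<le> -y) \<or> (y < 0 \<and> x \<ge> -y)"
      by (cases "y > 0") (auto simp: mult_le_0_iff)
    then show ?thesis by (auto simp: mult_le_0_iff)
  qed auto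
  have moves: "\<bar>\<xi> (A p)\<bar> = \<bar>\<xi> p\<bar> - \<bar>b * \<eta> p\<bar> \<and> b * \<eta> (A p) * \<xi> (A p) \<le> 0"
    if "b * \<eta> p * \<xi> p \<le> 0" "\<bar>b * \<eta> p\<bar> \<le> \<bar>\<xi> p\<bar>" for p
    using key[OF that] by (simp add: \<xi>A \<eta>A)
  have Q: "\<forall>\<^sub>F p in nhds 0. p \<in> T \<longrightarrow> \<bar>\<xi> (A p)\<bar> = \<bar>\<xi> p\<bar> - \<bar>b * \<eta> p\<bar>"
    using step by eventually_elim (use moves in \<open>auto simp: T_def\<close>)
  have invT: "\<forall>\<^sub>F p in nhds 0. p \<in> T \<longrightarrow> A p \<in> T"
    using step inv by eventually_elim (use moves in \<open>auto simp: T_def\<close>)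
  have dec: "\<forall>\<^sub>F p in nhds 0. p \<in> T \<longrightarrow> \<bar>\<xi> (A p)\<bar> \<le> \<bar>\<xi> p\<bar>"
    using Q by eventually_elim auto
  have compT: "\<forall>\<^sub>F p in nhds 0. p \<in> T \<longrightarrow> norm p \<le> K * \<bar>\<xi> p\<bar>"
    using comp by eventually_elim (auto simp: T_def)
  obtain D where D: "\<forall>\<^sub>F p in nhds 0. p \<in> T \<longrightarrow> p \<in> D" "\<And>p. p \<in> D \<Longrightarrow> A p \<in> D"
    "\<And>p. p \<in> D \<Longrightarrow> \<bar>\<xi> (A p)\<bar> = \<bar>\<xi> p\<bar> - \<bar>b * \<eta> p\<bar>"
    using trapping_region[OF A \<xi> invT compT dec Q] by blast
  have "\<eta> p = 0" if p: "p \<in> D" for p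
  proof (rule ccontr)
    assume "\<eta> p \<noteq> 0"
    then have pos: "\<bar>b * \<eta> p\<bar> > 0" using b by simp
    have it: "(A ^^ n) p \<in> D \<and> \<bar>\<xi> ((A ^^ n) p)\<bar> = \<bar>\<xi> p\<bar> - real n * \<bar>b * \<eta> p\<bar> \<and> \<eta> ((A ^^ n) p) = \<eta> p" for n
    proof (induction n)
      case (Suc n)
      then show ?case using D(2,3)[of "(A ^^ n) p"] \<eta>A by (simp add: algebra_simps)
    qed (use p in auto)
    \<comment> \<open>By then the accumulated steps exceed the initial \<bar>\<xi> p\<bar>, which
      would make an absolute value negative.\<close>
    obtain n where "\<bar>\<xi> p\<bar> < real n * \<bar>b * \<eta> p\<bar>" using reals_Archimedean3[OF pos] by blast
    then show False using it[of n] by linarith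
  qed
  with D(1) show ?thesis by (auto simp: T_def elim: eventually_mono)
qed


section \<open>Triangular maps acting on a set tangent to the first axis\<close>

text \<open>In the coordinates \<open>\<xi>\<close>, \<open>\<eta>\<close> the map \<open>A\<close>
  is upper triangular and \<open>B\<close> acts as its inverse. Carrying both makes the assumptions
  stable under exchanging them and under squaring, so each result also applies to the inverse and to
  the square. \<open>order\<close> is the dichotomy between a flat curve and one with a leading
  monomial.\<close>

locale tangent_curve_dynamics =
  fixes S :: "'a::real_normed_vector set" and A B :: "'a \<Rightarrow> 'a" and \<xi> \<eta> :: "'a \<Rightarrow> real"
    and a b d K M :: real
  assumes A: "(A \<longlongrightarrow> 0) (nhds 0)" and B: "(B \<longlongrightarrow> 0) (nhds 0)"
    and \<xi>: "(\<xi> \<longlongrightarrow> 0) (nhds 0)"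
    and invA: "\<forall>\<^sub>F p in nhds 0. p \<in> S \<longrightarrow> A p \<in> S"
    and invB: "\<forall>\<^sub>F p in nhds 0. p \<in> S \<longrightarrow> B p \<in> S"
    and nz: "a \<noteq> 0" "d \<noteq> 0" and diag: "a \<noteq> d \<Longrightarrow> b = 0"
    and \<xi>A: "\<xi> (A p) = a * \<xi> p + b * \<eta> p" and \<eta>A: "\<eta> (A p) = d * \<eta> p"
    and \<xi>B: "\<xi> (B p) = (\<xi> p - b / d * \<eta> p) / a" and \<eta>B: "\<eta> (B p) = \<eta> p / d"
    and comp: "\<forall>\<^sub>F p in nhds 0. p \<in> S \<longrightarrow> norm p \<le> K * \<bar>\<xi> p\<bar>"
    and tan: "\<forall>\<^sub>F p in nhds 0. p \<in> S \<longrightarrow> \<bar>\<eta> p\<bar> \<le> M * \<bar>\<xi> p\<bar> ^ 2"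
    and acc: "\<exists>\<^sub>F p in nhds 0. p \<in> S \<and> \<xi> p \<noteq> 0"
    and order: "(\<forall>n. \<exists>C. \<forall>\<^sub>F p in nhds 0. p \<in> S \<longrightarrow> \<bar>\<eta> p\<bar> \<le> C * \<bar>\<xi> p\<bar> ^ n) \<or>
      (\<exists>k \<alpha> C. k \<ge> 2 \<and> \<alpha> \<noteq> 0 \<and>
        (\<forall>\<^sub>F p in nhds 0. p \<in> S \<longrightarrow> \<bar>\<eta> p - \<alpha> * \<xi> p ^ k\<bar> \<le> C * \<bar>\<xi> p\<bar> ^ Suc k))"
begin

lemma \<xi>_less: "e > 0 \<Longrightarrow> \<forall>\<^sub>F p in nhds 0. \<bar>\<xi> p\<bar> < e"
  using \<xi> by (intro order_tendstoD(2)[where y="0::real"] tendsto_rabs_zero) auto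

text \<open>By tangency \<open>b * \<eta> p\<close> is quadratic in \<open>\<xi> p\<close>, so close
  enough to 0 it fits into the margin \<open>c - \<bar>a\<bar>\<close>.\<close>

lemma near_contraction:
  assumes "\<bar>a\<bar> < c"
  shows "\<forall>\<^sub>F p in nhds 0. p \<in> S \<longrightarrow> \<bar>\<xi> (A p)\<bar> \<le> c * \<bar>\<xi> p\<bar>"
proof -
  have "(c - \<bar>a\<bar>) / (\<bar>b\<bar> * \<bar>M\<bar> + 1) > 0" using assms by (simp add: add_nonneg_pos)
  from \<xi>_less[OF this] tan show ?thesis
  proof eventually_elim
    case (elim p)
    show ?case
    proof
      assume "p \<in> S"
      then have "\<bar>\<eta> p\<bar> \<le> M * \<bar>\<xi> p\<bar> ^ 2" using elim by auto
      also have "\<dots> \<le> \<bar>M\<bar> * \<bar>\<xi> p\<bar> ^ 2" by (intro mult_right_mono) auto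
      finally have "\<bar>b * \<eta> p\<bar> \<le> (\<bar>b\<bar> * \<bar>M\<bar> * \<bar>\<xi> p\<bar>) * \<bar>\<xi> p\<bar>"
        by (simp add: abs_mult power2_eq_square mult.assoc mult_left_mono)
      also have "\<bar>b\<bar> * \<bar>M\<bar> * \<bar>\<xi> p\<bar> \<le> (\<bar>b\<bar> * \<bar>M\<bar> + 1) * ((c - \<bar>a\<bar>) / (\<bar>b\<bar> * \<bar>M\<bar> + 1))"
        using elim assms by (intro mult_mono) auto
      also have "\<dots> = c - \<bar>a\<bar>" by (simp add: add_nonneg_eq_0_iff)
      finally have "\<bar>b * \<eta> p\<bar> \<le> (c - \<bar>a\<bar>) * \<bar>\<xi> p\<bar>" by (simp add: mult_right_mono)
      then have "\<bar>a * \<xi> p\<bar> + \<bar>b * \<eta> p\<bar> \<le> c * \<bar>\<xi> p\<bar>" by (simp add: algebra_simps abs_mult)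
      then show "\<bar>\<xi> (A p)\<bar> \<le> c * \<bar>\<xi> p\<bar>" unfolding \<xi>A by linarith
    qed
  qed
qed

text \<open>\<open>near_contraction\<close> costs an arbitrarily small enlargement of \<bar>a\<bar>
  to some \<open>c\<close>. As \<open>c\<close> decreases to \<bar>a\<bar>, \<open>c ^ m\<close>
  tends to \<open>\<bar>a\<bar> ^ m\<close>, so both strict inequalities survive for a suitable
  \<open>c\<close>.\<close>

lemma vanishing_transversal:
  assumes "\<bar>a\<bar> < 1" "\<bar>a\<bar> ^ m < \<bar>d\<bar>"
    and "\<forall>\<^sub>F p in nhds 0. p \<in> S \<longrightarrow> \<bar>\<eta> p\<bar> \<le> C * \<bar>\<xi> p\<bar> ^ m"
  shows "\<forall>\<^sub>F p in nhds 0. p \<in> S \<longrightarrow> \<eta> p = 0"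
proof -
  have "((\<lambda>c. c ^ m) \<longlongrightarrow> \<bar>a\<bar> ^ m) (at_right \<bar>a\<bar>)" by (intro tendsto_intros)
  then have "\<forall>\<^sub>F c in at_right \<bar>a\<bar>. c ^ m < \<bar>d\<bar>" using assms(2) by (rule order_tendstoD)
  moreover have "\<forall>\<^sub>F c in at_right \<bar>a\<bar>. \<bar>a\<bar> < c \<and> c < 1"
    using assms(1) by (auto simp: eventually_at_right_field)
  ultimately have "\<forall>\<^sub>F c in at_right \<bar>a\<bar>. c ^ m < \<bar>d\<bar> \<and> \<bar>a\<bar> < c \<and> c < 1" by eventually_elim auto
  then obtain c where c: "c ^ m < \<bar>d\<bar>" "\<bar>a\<bar> < c" "c < 1"
    by (metis (mono_tags, lifting) eventually_happens' trivial_limit_at_right_real)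
  show ?thesis
    using contracted_eigenfunction_vanishes[OF A \<xi> invA comp _ _ near_contraction[OF c(2)] assms(3) \<eta>A c(1)] c
    by auto
qed

text \<open>Comparing the terms of degree \<open>k\<close> in
  \<open>\<eta> (A p) = d * \<eta> p\<close> gives \<alpha> a^k = d \<alpha>, because
  \<open>S\<close> has points with \<open>\<xi> p \<noteq> 0\<close> arbitrarily close to 0.\<close>

lemma eigenvalue_resonance:
  assumes b: "b = 0" and \<alpha>: "\<alpha> \<noteq> 0"
    and ev: "\<forall>\<^sub>F p in nhds 0. p \<in> S \<longrightarrow> \<bar>\<eta> p - \<alpha> * \<xi> p ^ k\<bar> \<le> C * \<bar>\<xi> p\<bar> ^ Suc k"
  shows "d = a ^ k"
proof (rule ccontr)
  assume ne: "d \<noteq> a ^ k"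
  \<comment> \<open>\<open>L\<close> is the size of the leading coefficient left over if
    \<open>d\<close> differs from \<open>a ^ k\<close>; \<open>R\<close> adds the error constants at
    \<open>A p\<close> and at \<open>p\<close>. Then \<open>L \<le> R * \<bar>\<xi> p\<bar>\<close>
    wherever \<open>\<xi> p \<noteq> 0\<close>, which fails near 0.\<close>
  define L where "L = \<bar>\<alpha>\<bar> * \<bar>d - a ^ k\<bar>"
  have L: "L > 0" using ne \<alpha> by (simp add: L_def)
  define R where "R = \<bar>C\<bar> * \<bar>a\<bar> ^ Suc k + \<bar>d\<bar> * \<bar>C\<bar>"
  have R: "R \<ge> 0" by (simp add: R_def)
  have evA: "\<forall>\<^sub>F p in nhds 0. A p \<in> S \<longrightarrow> \<bar>\<eta> (A p) - \<alpha> * \<xi> (A p) ^ k\<bar> \<le> C * \<bar>\<xi> (A p)\<bar> ^ Suc k"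
    by (rule A[unfolded filterlim_iff, rule_format, OF ev])
  have "\<forall>\<^sub>F p in nhds 0. \<bar>\<xi> p\<bar> < L / (R + 1)"
    using L R by (intro \<xi>_less) auto
  with evA ev invA have "\<forall>\<^sub>F p in nhds 0. \<not> (p \<in> S \<and> \<xi> p \<noteq> 0)"
  proof eventually_elim
    case (elim p)
    show ?case
    proof
      assume p: "p \<in> S \<and> \<xi> p \<noteq> 0"
      have "\<bar>d * \<eta> p - \<alpha> * (a * \<xi> p) ^ k\<bar> \<le> C * \<bar>a * \<xi> p\<bar> ^ Suc k"
        using elim p by (simp add: \<eta>A \<xi>A b)
      also have "\<dots> \<le> \<bar>C\<bar> * \<bar>a * \<xi> p\<bar> ^ Suc k" by (intro mult_right_mono) auto
      finally have 1: "\<bar>d * \<eta> p - \<alpha> * (a * \<xi> p) ^ k\<bar> \<le> \<bar>C\<bar> * \<bar>a\<bar> ^ Suc k * \<bar>\<xi> p\<bar> ^ Suc k"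
        by (simp add: abs_mult power_mult_distrib mult_ac)
      have "\<bar>\<eta> p - \<alpha> * \<xi> p ^ k\<bar> \<le> C * \<bar>\<xi> p\<bar> ^ Suc k" using elim p by auto
      also have "\<dots> \<le> \<bar>C\<bar> * \<bar>\<xi> p\<bar> ^ Suc k" by (intro mult_right_mono) auto
      finally have "\<bar>d\<bar> * \<bar>\<eta> p - \<alpha> * \<xi> p ^ k\<bar> \<le> \<bar>d\<bar> * (\<bar>C\<bar> * \<bar>\<xi> p\<bar> ^ Suc k)"
        by (intro mult_left_mono) auto
      then have 2: "\<bar>d * (\<eta> p - \<alpha> * \<xi> p ^ k)\<bar> \<le> \<bar>d\<bar> * \<bar>C\<bar> * \<bar>\<xi> p\<bar> ^ Suc k"
        by (simp add: abs_mult mult.assoc)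
      have "\<alpha> * (d - a ^ k) * \<xi> p ^ k = (d * \<eta> p - \<alpha> * (a * \<xi> p) ^ k) - d * (\<eta> p - \<alpha> * \<xi> p ^ k)"
        by (simp add: algebra_simps power_mult_distrib)
      then have "\<bar>\<alpha> * (d - a ^ k) * \<xi> p ^ k\<bar> \<le> R * \<bar>\<xi> p\<bar> ^ Suc k"
        using 1 2 unfolding R_def by (simp only: distrib_right) linarith
      then have "L * \<bar>\<xi> p\<bar> ^ k \<le> (R * \<bar>\<xi> p\<bar>) * \<bar>\<xi> p\<bar> ^ k"
        by (simp add: L_def abs_mult power_abs mult_ac)
      then have "L \<le> R * \<bar>\<xi> p\<bar>" using p by (simp add: mult_le_cancel_right)
      also have "\<dots> \<le> (R + 1) * \<bar>\<xi> p\<bar>" by (intro mult_right_mono) auto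
      also have "\<dots> < (R + 1) * (L / (R + 1))" using elim R by (intro mult_strict_left_mono) auto
      also have "\<dots> = L" using R by simp
      finally show False by simp
    qed
  qed
  then show False using acc by (simp add: frequently_def)
qed

lemma monomial_if_contracting:
  assumes a: "\<bar>a\<bar> < 1"
  shows "\<exists>\<alpha> k. k \<ge> 2 \<and> (\<forall>\<^sub>F p in nhds 0. p \<in> S \<longrightarrow> \<eta> p = \<alpha> * \<xi> p ^ k)"
proof -
  have *: ?thesis if "\<forall>\<^sub>F p in nhds 0. p \<in> S \<longrightarrow> \<eta> p = 0"
    using that by (intro exI[of _ 0] exI[of _ 2]) auto
  from order show ?thesis
  proof (elim disjE exE conjE)
    assume flat: "\<forall>n. \<exists>C. \<forall>\<^sub>F p in nhds 0. p \<in> S \<longrightarrow> \<bar>\<eta> p\<bar> \<le> C * \<bar>\<xi> p\<bar> ^ n"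
    \<comment> \<open>Flatness supplies a bound of every order, in particular of one that beats
      \<open>d\<close>.\<close>
    obtain m where "\<bar>a\<bar> ^ m < \<bar>d\<bar>" using real_arch_pow_inv[of "\<bar>d\<bar>" "\<bar>a\<bar>"] a nz by auto
    then show ?thesis using flat vanishing_transversal[OF a] * by blast
  next
    fix k \<alpha> C assume k: "k \<ge> 2" and \<alpha>: "\<alpha> \<noteq> 0"
      and ev: "\<forall>\<^sub>F p in nhds 0. p \<in> S \<longrightarrow> \<bar>\<eta> p - \<alpha> * \<xi> p ^ k\<bar> \<le> C * \<bar>\<xi> p\<bar> ^ Suc k"
    show ?thesis
    proof (cases "\<bar>a\<bar> ^ k < \<bar>d\<bar>")
      case True
      have "\<forall>\<^sub>F p in nhds 0. \<bar>\<xi> p\<bar> < 1" by (rule \<xi>_less) auto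
      then have "\<forall>\<^sub>F p in nhds 0. p \<in> S \<longrightarrow> \<bar>\<eta> p\<bar> \<le> (\<bar>\<alpha>\<bar> + \<bar>C\<bar>) * \<bar>\<xi> p\<bar> ^ k"
        using ev
      proof eventually_elim
        case (elim p)
        have "C * \<bar>\<xi> p\<bar> ^ Suc k \<le> \<bar>C\<bar> * \<bar>\<xi> p\<bar> ^ k"
          using elim by (intro mult_mono power_decreasing) auto
        moreover have "\<bar>\<eta> p\<bar> \<le> \<bar>\<eta> p - \<alpha> * \<xi> p ^ k\<bar> + \<bar>\<alpha>\<bar> * \<bar>\<xi> p\<bar> ^ k"
          using abs_triangle_ineq[of "\<eta> p - \<alpha> * \<xi> p ^ k" "\<alpha> * \<xi> p ^ k"] by (simp add: abs_mult power_abs)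
        ultimately show ?case using elim unfolding distrib_right by linarith
      qed
      from vanishing_transversal[OF a True this] show ?thesis by (rule *)
    next
      case False
      \<comment> \<open>Since \<open>k \<ge> 2\<close>, now \<bar>d\<bar> \<le> \<bar>a\<bar>^k <
        \<bar>a\<bar>; the eigenvalues differ and the map is diagonal.\<close>
      have "\<bar>a\<bar> ^ k < \<bar>a\<bar> ^ 1" using a k nz by (intro power_strict_decreasing) auto
      then have "a \<noteq> d" using False by auto
      then have b: "b = 0" by (rule diag)
      have d: "d = a ^ k" by (rule eigenvalue_resonance[OF b \<alpha> ev])
      have "\<forall>\<^sub>F p in nhds 0. p \<in> S \<longrightarrow> \<eta> p - \<alpha> * \<xi> p ^ k = 0"
      \<comment> \<open>With \<open>b = 0\<close> and \<open>d = a ^ k\<close> the difference is an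
        eigenfunction for \<open>d\<close>, and the contraction factor is exactly \<bar>a\<bar>. The
        one extra order in the error bound gives
        \<open>\<bar>a\<bar> ^ Suc k < \<bar>d\<bar>\<close>.\<close>
      proof (rule contracted_eigenfunction_vanishes[OF A \<xi> invA comp _ _ _ ev])
        show "\<eta> (A p) - \<alpha> * \<xi> (A p) ^ k = d * (\<eta> p - \<alpha> * \<xi> p ^ k)" for p
          by (simp add: \<eta>A \<xi>A b d power_mult_distrib algebra_simps)
        show "\<bar>a\<bar> ^ Suc k < \<bar>d\<bar>" using a nz by (simp add: d power_abs)
      qed (use a b in \<open>auto simp: \<xi>A abs_mult\<close>)
      then show ?thesis using k by (intro exI[of _ \<alpha>] exI[of _ k]) auto
    qed
  qed
qed

text \<open>The map is diagonal and preserves \<bar>\<xi>\<bar>, so the contraction argument runs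
  with \<open>c = 1\<close>, and the tangency bound (\<open>m = 2\<close>) is enough against
  \<open>\<bar>d\<bar> > 1\<close>.\<close>

lemma line_if_neutral:
  assumes a: "\<bar>a\<bar> = 1" and d: "\<bar>d\<bar> > 1"
  shows "\<forall>\<^sub>F p in nhds 0. p \<in> S \<longrightarrow> \<eta> p = 0"
proof -
  have b: "b = 0" using a d by (intro diag) auto
  show ?thesis
    by (rule contracted_eigenfunction_vanishes[OF A \<xi> invA comp, of 1 \<eta> M 2 d])
      (use a b d tan \<eta>A \<xi>A in \<open>auto simp: abs_mult\<close>)
qed

text \<open>\<open>A\<close> and \<open>B\<close> displace \<open>\<xi>\<close> by
  \<open>b * \<eta> p\<close> and its negative, so at each point of \<open>S\<close> one of the two
  moves in the direction that \<open>shear_towards_axis\<close> treats.\<close>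

lemma line_if_shear:
  assumes a: "a = 1" "d = 1" and b: "b \<noteq> 0"
  shows "\<forall>\<^sub>F p in nhds 0. p \<in> S \<longrightarrow> \<eta> p = 0"
proof -
  have "\<forall>\<^sub>F p in nhds 0. p \<in> S \<and> b * \<eta> p * \<xi> p \<le> 0 \<longrightarrow> \<eta> p = 0"
    by (rule shear_towards_axis[OF A \<xi> invA comp tan]) (use a b \<xi>A \<eta>A in auto)
  moreover have "\<forall>\<^sub>F p in nhds 0. p \<in> S \<and> (- b) * \<eta> p * \<xi> p \<le> 0 \<longrightarrow> \<eta> p = 0"
    by (rule shear_towards_axis[OF B \<xi> invB comp tan]) (use a b \<xi>B \<eta>B in auto)
  ultimately show ?thesis by eventually_elim (auto simp: not_le)
qed

lemma inverse_dynamics: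
  "tangent_curve_dynamics S B A \<xi> \<eta> (1 / a) (- b / (a * d)) (1 / d) K M"
  by unfold_locales (use A B \<xi> invA invB nz comp tan acc order in
    \<open>auto simp: \<xi>A \<eta>A \<xi>B \<eta>B field_simps dest: diag\<close>)

text \<open>Squaring turns eigenvalues 1 and -1 into 1, which brings the case \<bar>a\<bar> =
  \<bar>d\<bar> = 1 under \<open>line_if_shear\<close>.\<close>

lemma squared_dynamics:
  "tangent_curve_dynamics S (A \<circ> A) (B \<circ> B) \<xi> \<eta> (a ^ 2) (b * (a + d)) (d ^ 2) K M"
proof unfold_locales
  show "((A \<circ> A) \<longlongrightarrow> 0) (nhds 0)" "((B \<circ> B) \<longlongrightarrow> 0) (nhds 0)"
    unfolding o_def using A B by (auto intro: filterlim_compose)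
  show "\<forall>\<^sub>F p in nhds 0. p \<in> S \<longrightarrow> (A \<circ> A) p \<in> S"
    using invA A[unfolded filterlim_iff, rule_format, OF invA] by eventually_elim auto
  show "\<forall>\<^sub>F p in nhds 0. p \<in> S \<longrightarrow> (B \<circ> B) p \<in> S"
    using invB B[unfolded filterlim_iff, rule_format, OF invB] by eventually_elim auto
  show "\<xi> ((B \<circ> B) p) = (\<xi> p - b * (a + d) / d\<^sup>2 * \<eta> p) / a\<^sup>2" for p
    using nz by (simp add: \<xi>B \<eta>B field_simps power2_eq_square)
  show "b * (a + d) = 0" if "a\<^sup>2 \<noteq> d\<^sup>2"
    using diag that by auto
qed (use A B \<xi> nz comp tan acc order in
  \<open>auto simp: \<xi>A \<eta>A \<eta>B power2_eq_square algebra_simps\<close>)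

text \<open>The hypothesis lists the entries \<open>a ^ 2\<close>, \<open>d ^ 2\<close>,
  \<open>b * (a + d)\<close> of the squared matrix and says that it is not the identity. The inverse
  handles \<bar>a\<bar> > 1, and \<bar>d\<bar> < 1 with \<bar>a\<bar> = 1; if both moduli are 1,
  only \<open>b * (a + d) \<noteq> 0\<close> remains, and the square is a shear.\<close>

theorem curve_is_monomial:
  assumes "a ^ 2 \<noteq> 1 \<or> d ^ 2 \<noteq> 1 \<or> b * (a + d) \<noteq> 0"
  shows "\<exists>\<alpha> k. k \<ge> 2 \<and> (\<forall>\<^sub>F p in nhds 0. p \<in> S \<longrightarrow> \<eta> p = \<alpha> * \<xi> p ^ k)"
proof -
  interpret inv: tangent_curve_dynamics S B A \<xi> \<eta> "1 / a" "- b / (a * d)" "1 / d" K M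
    by (rule inverse_dynamics)
  interpret sq: tangent_curve_dynamics S "A \<circ> A" "B \<circ> B" \<xi> \<eta> "a ^ 2" "b * (a + d)" "d ^ 2" K M
    by (rule squared_dynamics)
  have line: ?thesis if "\<forall>\<^sub>F p in nhds 0. p \<in> S \<longrightarrow> \<eta> p = 0"
    using that by (intro exI[of _ 0] exI[of _ 2]) auto
  consider "\<bar>a\<bar> < 1" | "\<bar>a\<bar> > 1" | "\<bar>a\<bar> = 1" "\<bar>d\<bar> > 1" | "\<bar>a\<bar> = 1" "\<bar>d\<bar> < 1" | "\<bar>a\<bar> = 1" "\<bar>d\<bar> = 1"
    by linarith
  then show ?thesis
  proof cases
    case 1 then show ?thesis by (rule monomial_if_contracting)
  next
    case 2 then show ?thesis by (intro inv.monomial_if_contracting) (auto simp: field_simps)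
  next
    case 3 then show ?thesis by (intro line line_if_neutral)
  next
    case 4 then show ?thesis using nz by (intro line inv.line_if_neutral) (auto simp: field_simps)
  next
    case 5
    then have "a ^ 2 = 1" "d ^ 2 = 1" by (simp_all add: abs_square_eq_1)
    with assms show ?thesis by (intro line sq.line_if_shear) auto
  qed
qed

end

section \<open>Smooth plane curves\<close>

text \<open>Induction on \<open>n\<close>: the derivative in direction \<open>e\<close> is expanded
  and integrated term by term, and the mean value inequality turns its error into one of the next
  order. For \<open>n = 0\<close> the claim is local boundedness.\<close>

lemma Ck_on_directional_Taylor:
  assumes "Ck_on n f U" "open U" "p \<in> U"
  shows "\<exists>a C. \<forall>\<^sub>F t in nhds 0. norm (f (p + t *\<^sub>R e) - (\<Sum>i<n. t ^ i *\<^sub>R a i)) \<le> C * \<bar>t\<bar> ^ n"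
  using assms(1)
proof (induction n arbitrary: f)
  case 0
  then have "isCont f p" using assms by (simp add: continuous_on_eq_continuous_at)
  then have "isCont (\<lambda>t. f (p + t *\<^sub>R e)) 0"
    using isCont_o2[of 0 "\<lambda>t. p + t *\<^sub>R e" f] by simp
  then have "((\<lambda>t. norm (f (p + t *\<^sub>R e))) \<longlongrightarrow> norm (f p)) (nhds 0)"
    using tendsto_at_iff_tendsto_nhds[of "\<lambda>t. f (p + t *\<^sub>R e)" 0] by (simp add: isCont_def tendsto_norm)
  then have "\<forall>\<^sub>F t in nhds 0. norm (f (p + t *\<^sub>R e)) < norm (f p) + 1"
    by (rule order_tendstoD) simp
  then show ?case by (intro exI[of _ "\<lambda>_. 0"] exI[of _ "norm (f p) + 1"]) (auto elim: eventually_mono)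
next
  case (Suc n)
  from Suc.prems obtain f' where f': "\<And>x. x \<in> U \<Longrightarrow> (f has_derivative f' x) (at x)"
    "\<And>v. Ck_on n (\<lambda>x. f' x v) U"
    by auto
  obtain a C where aC: "\<forall>\<^sub>F t in nhds 0. norm (f' (p + t *\<^sub>R e) e - (\<Sum>i<n. t ^ i *\<^sub>R a i)) \<le> C * \<bar>t\<bar> ^ n"
    using Suc.IH[OF f'(2)] by blast
  have "open ((\<lambda>t. p + t *\<^sub>R e) -` U)"
    using assms by (intro open_vimage) (auto intro!: continuous_intros)
  then have "\<forall>\<^sub>F t in nhds 0. p + t *\<^sub>R e \<in> U"
    using assms(3) by (auto simp: eventually_nhds)
  with aC have "\<forall>\<^sub>F t in nhds 0. p + t *\<^sub>R e \<in> U \<and> norm (f' (p + t *\<^sub>R e) e - (\<Sum>i<n. t ^ i *\<^sub>R a i)) \<le> C * \<bar>t\<bar> ^ n"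
    by eventually_elim auto
  then obtain r where r: "r > 0" and *: "\<And>t. \<bar>t\<bar> < r \<Longrightarrow> p + t *\<^sub>R e \<in> U \<and>
      norm (f' (p + t *\<^sub>R e) e - (\<Sum>i<n. t ^ i *\<^sub>R a i)) \<le> C * \<bar>t\<bar> ^ n"
    by (auto simp: eventually_nhds_metric)
  \<comment> \<open>Termwise integration: the constant is \<open>f p\<close>, and t^j a_j becomes
    t^(j+1) a_j / (j+1).\<close>
  define a' where "a' = (\<lambda>i. case i of 0 \<Rightarrow> f p | Suc j \<Rightarrow> a j /\<^sub>R real (Suc j))"
  define h where "h = (\<lambda>t. f (p + t *\<^sub>R e) - (\<Sum>i<Suc n. t ^ i *\<^sub>R a' i))"
  define h' where "h' = (\<lambda>t. f' (p + t *\<^sub>R e) e - (\<Sum>i<n. t ^ i *\<^sub>R a i))"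
  have h_eq: "h = (\<lambda>t. f (p + t *\<^sub>R e) - (f p + (\<Sum>i<n. (t ^ Suc i / real (Suc i)) *\<^sub>R a i)))"
    unfolding h_def by (subst sum.lessThan_Suc_shift) (simp add: a'_def divide_inverse mult_ac)
  have h: "(h has_derivative (\<lambda>s. s *\<^sub>R h' t)) (at t within X)" if "\<bar>t\<bar> < r" for t :: real and X
  proof -
    have 1: "((\<lambda>t. f (p + t *\<^sub>R e)) has_derivative (\<lambda>s. f' (p + t *\<^sub>R e) (s *\<^sub>R e))) (at t within X)"
      by (rule has_derivative_compose[where g=f and f="\<lambda>t. p + t *\<^sub>R e"])
        (use * that f'(1) in \<open>auto intro!: derivative_eq_intros\<close>)
    interpret bounded_linear "f' (p + t *\<^sub>R e)" using f'(1) * that has_derivative_bounded_linear by blast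
    have 2: "((\<lambda>t. t ^ Suc i / real (Suc i)) has_derivative (\<lambda>s. s * t ^ i)) (at t within X)" for i
      by (auto intro!: derivative_eq_intros simp: field_simps simp del: of_nat_Suc power_Suc)
    show ?thesis unfolding h_eq h'_def
      by (rule has_derivative_eq_rhs[OF has_derivative_diff[OF 1 has_derivative_add[OF has_derivative_const
          has_derivative_sum[OF has_derivative_scaleR_left[OF 2]]]]])
        (simp add: scale scaleR_diff_right scaleR_sum_right)
  qed
  have "norm (h t) \<le> \<bar>C\<bar> * \<bar>t\<bar> ^ Suc n" if t: "\<bar>t\<bar> < r" for t :: real
  proof -
    \<comment> \<open>Mean value inequality on the interval of radius \<bar>t\<bar>; its length
      supplies the extra factor \<bar>t\<bar>.\<close>
    have "norm (h t - h 0) \<le> (\<bar>C\<bar> * \<bar>t\<bar> ^ n) * norm (t - 0)"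
    proof (rule differentiable_bound[where S="cball 0 \<bar>t\<bar>"])
      fix s :: real assume s: "s \<in> cball 0 \<bar>t\<bar>"
      show "(h has_derivative (\<lambda>u. u *\<^sub>R h' s)) (at s within cball 0 \<bar>t\<bar>)"
        using s t by (intro h) auto
      have "norm (h' s) \<le> C * \<bar>s\<bar> ^ n" using s t * by (simp add: h'_def)
      also have "\<dots> \<le> \<bar>C\<bar> * \<bar>s\<bar> ^ n" by (intro mult_right_mono) auto
      also have "\<dots> \<le> \<bar>C\<bar> * \<bar>t\<bar> ^ n" using s by (intro mult_left_mono power_mono) auto
      finally show "onorm (\<lambda>u. u *\<^sub>R h' s) \<le> \<bar>C\<bar> * \<bar>t\<bar> ^ n"
        by (intro onorm_le) (simp add: mult.commute[of "\<bar>C\<bar> * _"] mult_left_mono)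
    qed auto
    moreover have "h 0 = 0" by (simp add: h_eq)
    ultimately show ?thesis by (simp add: mult_ac)
  qed
  then have "\<forall>\<^sub>F t in nhds 0. norm (h t) \<le> \<bar>C\<bar> * \<bar>t\<bar> ^ Suc n"
    using r unfolding eventually_nhds_metric by (intro exI[of _ r]) simp
  then show ?case unfolding h_def by blast
qed

text \<open>Dividing by t^k for t > 0 bounds \<bar>b\<bar> by C t, which tends to 0.\<close>

lemma coefficient_zero_if_higher_order:
  fixes b C :: real
  assumes "\<forall>\<^sub>F t in nhds 0. \<bar>b\<bar> * \<bar>t\<bar> ^ k \<le> C * \<bar>t\<bar> ^ Suc k"
  shows "b = 0"
proof -
  have "\<forall>\<^sub>F t in at_right 0. \<bar>b\<bar> * \<bar>t\<bar> ^ k \<le> C * \<bar>t\<bar> ^ Suc k"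
    using assms by (rule filter_leD[rotated]) (simp add: at_within_le_nhds)
  moreover have "\<forall>\<^sub>F t::real in at_right 0. t > 0" by (simp add: eventually_at_right_less)
  ultimately have "\<forall>\<^sub>F t in at_right 0. \<bar>b\<bar> \<le> C * t"
    by eventually_elim simp
  moreover have "((\<lambda>t. C * t) \<longlongrightarrow> C * 0) (at_right 0)" by (intro tendsto_intros)
  ultimately have "\<bar>b\<bar> \<le> C * 0" by (intro tendsto_lowerbound) auto
  then show ?thesis by simp
qed

text \<open>Induction on \<open>k\<close>, splitting the difference into
  \<open>x * (x ^ k - y ^ k) + (x - y) * y ^ k\<close>. It serves to replace a function along the
  curve by its linear part inside a k-th power.\<close>

lemma abs_power_diff_le:
  fixes C D :: real
  shows "\<exists>E. \<forall>x y t. \<bar>x - y\<bar> \<le> C * t ^ 2 \<longrightarrow> \<bar>x\<bar> \<le> D * \<bar>t\<bar> \<longrightarrow> \<bar>y\<bar> \<le> D * \<bar>t\<bar> \<longrightarrow>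
    \<bar>x ^ k - y ^ k\<bar> \<le> E * \<bar>t\<bar> ^ Suc k"
proof (induction k)
  case 0
  show ?case by (intro exI[of _ 0]) auto
next
  case (Suc k)
  then obtain E where E: "\<And>x y t. \<bar>x - y\<bar> \<le> C * t ^ 2 \<Longrightarrow> \<bar>x\<bar> \<le> D * \<bar>t\<bar> \<Longrightarrow> \<bar>y\<bar> \<le> D * \<bar>t\<bar> \<Longrightarrow>
    \<bar>x ^ k - y ^ k\<bar> \<le> E * \<bar>t\<bar> ^ Suc k" by blast
  have "\<bar>x ^ Suc k - y ^ Suc k\<bar> \<le> (D * E + C * D ^ k) * \<bar>t\<bar> ^ Suc (Suc k)"
    if "\<bar>x - y\<bar> \<le> C * t ^ 2" "\<bar>x\<bar> \<le> D * \<bar>t\<bar>" "\<bar>y\<bar> \<le> D * \<bar>t\<bar>" for x y t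
  proof -
    have "x ^ Suc k - y ^ Suc k = x * (x ^ k - y ^ k) + (x - y) * y ^ k" by (simp add: algebra_simps)
    then have "\<bar>x ^ Suc k - y ^ Suc k\<bar> \<le> \<bar>x\<bar> * \<bar>x ^ k - y ^ k\<bar> + \<bar>x - y\<bar> * \<bar>y\<bar> ^ k"
      by (metis abs_mult abs_triangle_ineq power_abs)
    also have "\<dots> \<le> (D * \<bar>t\<bar>) * (E * \<bar>t\<bar> ^ Suc k) + (C * t ^ 2) * (D * \<bar>t\<bar>) ^ k"
      using that E[OF that] by (intro add_mono mult_mono power_mono) auto
    also have "\<dots> = (D * E + C * D ^ k) * \<bar>t\<bar> ^ Suc (Suc k)"
      unfolding power2_abs[of t, symmetric]
      by (simp add: power_mult_distrib algebra_simps power2_eq_square del: abs_mult_self_eq)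
    finally show ?thesis .
  qed
  then show ?case by blast
qed

section \<open>Estimates along a parametrized curve\<close>

text \<open>\<open>c\<close> runs through \<open>S\<close> near 0 with velocity \<open>v\<close> at
  0, and \<open>\<tau>\<close> recovers the parameter on \<open>N\<close>. Local statements about
  points of \<open>S\<close> thus become statements about small \<open>t\<close>, where orders of
  vanishing are read off Taylor expansions.\<close>

locale parametrized_curve =
  fixes S N :: "'a::euclidean_space set" and c :: "real \<Rightarrow> 'a" and \<tau> :: "'a \<Rightarrow> real" and \<epsilon> :: real and v :: 'a
  assumes \<epsilon>: "\<epsilon> > 0" and N: "open N" "0 \<in> N"
    and cont_c: "continuous_on {-\<epsilon><..<\<epsilon>} c" and cont_\<tau>: "continuous_on N \<tau>"
    and c_0: "c 0 = 0" and c_in: "\<bar>t\<bar> < \<epsilon> \<Longrightarrow> c t \<in> S" and \<tau>_c: "\<bar>t\<bar> < \<epsilon> \<Longrightarrow> \<tau> (c t) = t"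
    and c_\<tau>: "p \<in> S \<Longrightarrow> p \<in> N \<Longrightarrow> \<bar>\<tau> p\<bar> < \<epsilon> \<and> c (\<tau> p) = p"
    and Taylor: "\<exists>a C. \<forall>\<^sub>F t in nhds 0. norm (c t - (\<Sum>i<n. t ^ i *\<^sub>R a i)) \<le> C * \<bar>t\<bar> ^ n"
    and v: "v \<noteq> 0" "\<exists>C. \<forall>\<^sub>F t in nhds 0. norm (c t - t *\<^sub>R v) \<le> C * t ^ 2"
begin

lemma tendsto_c: "(c \<longlongrightarrow> 0) (nhds 0)"
proof -
  have "isCont c 0" using cont_c \<epsilon> by (simp add: continuous_on_eq_continuous_at)
  then show ?thesis using tendsto_at_iff_tendsto_nhds[of c 0] by (simp add: isCont_def c_0)
qed

lemma \<tau>_0: "\<tau> 0 = 0" using \<tau>_c[of 0] \<epsilon> c_0 by simp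

lemma tendsto_\<tau>: "(\<tau> \<longlongrightarrow> 0) (nhds 0)"
proof -
  have "isCont \<tau> 0" using cont_\<tau> N by (simp add: continuous_on_eq_continuous_at)
  then show ?thesis using tendsto_at_iff_tendsto_nhds[of \<tau> 0] by (simp add: isCont_def \<tau>_0)
qed

lemma ev_t: "e > 0 \<Longrightarrow> \<forall>\<^sub>F t :: real in nhds 0. \<bar>t\<bar> < e"
  by (auto simp: eventually_nhds_metric)

lemma eventually_on_curve:
  assumes "\<forall>\<^sub>F t in nhds 0. P (c t)"
  shows "\<forall>\<^sub>F p in nhds 0. p \<in> S \<longrightarrow> P p"
proof -
  have "\<forall>\<^sub>F p in nhds 0. P (c (\<tau> p))"
    using tendsto_\<tau> assms unfolding filterlim_iff by blast
  moreover have "\<forall>\<^sub>F p in nhds 0. p \<in> N" using N by (simp add: eventually_nhds_in_open)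
  ultimately show ?thesis by eventually_elim (use c_\<tau> in force)
qed

lemma eventually_along_curve:
  assumes "\<forall>\<^sub>F p in nhds 0. p \<in> S \<longrightarrow> P p"
  shows "\<forall>\<^sub>F t in nhds 0. P (c t)"
proof -
  have "\<forall>\<^sub>F t in nhds 0. c t \<in> S \<longrightarrow> P (c t)"
    using tendsto_c assms unfolding filterlim_iff by blast
  with ev_t[OF \<epsilon>] show ?thesis by eventually_elim (use c_in in auto)
qed

lemma linear_approx:
  fixes L :: "'a \<Rightarrow> 'b::real_normed_vector"
  assumes "bounded_linear L"
  obtains C where "C \<ge> 0" "\<forall>\<^sub>F t in nhds 0. norm (L (c t) - t *\<^sub>R L v) \<le> C * t ^ 2"
proof -
  interpret bounded_linear L by fact
  obtain C where C: "\<forall>\<^sub>F t in nhds 0. norm (c t - t *\<^sub>R v) \<le> C * t ^ 2" using v by blast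
  obtain K where K: "K > 0" "\<And>x. norm (L x) \<le> norm x * K" using pos_bounded by blast
  show ?thesis
  proof
    show "\<forall>\<^sub>F t in nhds 0. norm (L (c t) - t *\<^sub>R L v) \<le> (\<bar>C\<bar> * K) * t ^ 2"
      using C
    proof eventually_elim
      case (elim t)
      have "norm (L (c t) - t *\<^sub>R L v) \<le> norm (c t - t *\<^sub>R v) * K"
        using K(2)[of "c t - t *\<^sub>R v"] by (simp add: diff scale)
      also have "\<dots> \<le> (\<bar>C\<bar> * t ^ 2) * K"
        using elim K(1) by (intro mult_right_mono order_trans[OF elim]) auto
      finally show ?case by (simp add: mult_ac)
    qed
  qed (use K in simp)
qed

lemma norm_linear_along_curve_le:
  fixes L :: "'a \<Rightarrow> 'b::real_normed_vector"
  assumes "bounded_linear L"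
  obtains C where "C \<ge> 0" "\<forall>\<^sub>F t in nhds 0. norm (L (c t)) \<le> C * \<bar>t\<bar>"
proof -
  obtain C where C: "C \<ge> 0" "\<forall>\<^sub>F t in nhds 0. norm (L (c t) - t *\<^sub>R L v) \<le> C * t ^ 2"
    using linear_approx[OF assms] .
  have "\<forall>\<^sub>F t in nhds 0. norm (L (c t)) \<le> (C + norm (L v)) * \<bar>t\<bar>"
    using C(2) ev_t[OF zero_less_one]
  proof eventually_elim
    case (elim t)
    have "\<bar>t\<bar> ^ 2 \<le> \<bar>t\<bar> ^ 1" using elim by (intro power_decreasing) auto
    then have "t ^ 2 \<le> \<bar>t\<bar>" by simp
    then have "C * t ^ 2 \<le> C * \<bar>t\<bar>" using C(1) by (rule mult_left_mono)
    moreover have "norm (L (c t)) \<le> norm (L (c t) - t *\<^sub>R L v) + norm (t *\<^sub>R L v)"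
      using norm_triangle_ineq[of "L (c t) - t *\<^sub>R L v" "t *\<^sub>R L v"] by simp
    ultimately show ?case using elim by (simp add: algebra_simps)
  qed
  then show ?thesis using C(1) by (intro that[of "C + norm (L v)"]) auto
qed

text \<open>\<open>A (c t)\<close> lies in \<open>S\<close>, where \<open>\<eta>\<close> is
  quadratically small, whereas \<open>\<eta> (A (c t))\<close> is \<open>t * \<eta> (A v)\<close> up
  to O(t^2); so the linear coefficient vanishes.\<close>

lemma tangent_line_invariant:
  assumes A: "bounded_linear A" and inv: "\<forall>\<^sub>F p in nhds 0. p \<in> S \<longrightarrow> A p \<in> S"
    and tan: "\<forall>\<^sub>F p in nhds 0. p \<in> S \<longrightarrow> \<bar>\<eta> p\<bar> \<le> M * norm p ^ 2"
    and \<eta>: "bounded_linear (\<eta> :: 'a \<Rightarrow> real)"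
  shows "\<eta> (A v) = 0"
proof -
  obtain C where C: "C \<ge> 0" "\<forall>\<^sub>F t in nhds 0. norm (\<eta> (A (c t)) - t *\<^sub>R \<eta> (A v)) \<le> C * t ^ 2"
    using linear_approx[OF bounded_linear_compose[OF \<eta> A]] .
  obtain D where D: "D \<ge> 0" "\<forall>\<^sub>F t in nhds 0. norm (A (c t)) \<le> D * \<bar>t\<bar>"
    using norm_linear_along_curve_le[OF A] .
  have "((\<lambda>p. A p) \<longlongrightarrow> 0) (nhds 0)"
    using bounded_linear.isCont[OF A continuous_ident, of 0] tendsto_at_iff_tendsto_nhds[of A 0]
    by (simp add: isCont_def bounded_linear.linear[OF A] linear_0)
  then have "\<forall>\<^sub>F p in nhds 0. A p \<in> S \<longrightarrow> \<bar>\<eta> (A p)\<bar> \<le> M * norm (A p) ^ 2"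
    using tan unfolding filterlim_iff by blast
  with inv have "\<forall>\<^sub>F p in nhds 0. p \<in> S \<longrightarrow> \<bar>\<eta> (A p)\<bar> \<le> M * norm (A p) ^ 2"
    by eventually_elim auto
  from eventually_along_curve[OF this] C(2) D(2)
  have "\<forall>\<^sub>F t in nhds 0. \<bar>\<eta> (A v)\<bar> * \<bar>t\<bar> ^ 1 \<le> (C + \<bar>M\<bar> * D ^ 2) * \<bar>t\<bar> ^ Suc 1"
  proof eventually_elim
    case (elim t)
    have "M * norm (A (c t)) ^ 2 \<le> \<bar>M\<bar> * (D * \<bar>t\<bar>) ^ 2"
      using elim D by (intro mult_mono power_mono) auto
    then have "\<bar>\<eta> (A (c t))\<bar> \<le> \<bar>M\<bar> * D ^ 2 * t ^ 2" using elim by (simp add: power_mult_distrib)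
    moreover have "\<bar>t * \<eta> (A v)\<bar> \<le> \<bar>\<eta> (A (c t))\<bar> + C * t ^ 2" using elim by simp
    ultimately have "\<bar>\<eta> (A v)\<bar> * \<bar>t\<bar> \<le> (C + \<bar>M\<bar> * D ^ 2) * t ^ 2" by (simp add: abs_mult algebra_simps)
    then show ?case by (simp add: power2_eq_square)
  qed
  then show ?thesis by (rule coefficient_zero_if_higher_order)
qed

text \<open>\<open>A\<close> maps a short arc of \<open>S\<close> around 0 into \<open>S\<close>.
  Read in the parameter this is a continuous injection of an interval into the line, hence open, so
  the image of the arc contains all points of \<open>S\<close> near 0.\<close>

lemma inverse_invariant:
  assumes A: "bounded_linear A" and BA: "\<And>p. B (A p) = p"
    and inv: "\<forall>\<^sub>F p in nhds 0. p \<in> S \<longrightarrow> A p \<in> S"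
  shows "\<forall>\<^sub>F p in nhds 0. p \<in> S \<longrightarrow> B p \<in> S"
proof -
  have A0: "A 0 = 0" using A by (simp add: bounded_linear.linear linear_0)
  have "((\<lambda>p. A p) \<longlongrightarrow> 0) (nhds 0)"
    using bounded_linear.isCont[OF A continuous_ident, of 0] tendsto_at_iff_tendsto_nhds[of A 0]
    by (simp add: isCont_def A0)
  moreover have "\<forall>\<^sub>F p in nhds 0. p \<in> N" using N by (simp add: eventually_nhds_in_open)
  ultimately have "\<forall>\<^sub>F p in nhds 0. A p \<in> N" unfolding filterlim_iff by blast
  with inv have "\<forall>\<^sub>F p in nhds 0. p \<in> S \<longrightarrow> A p \<in> S \<inter> N" by eventually_elim auto
  from eventually_along_curve[OF this] ev_t[OF \<epsilon>]
  have "\<forall>\<^sub>F t in nhds 0. A (c t) \<in> S \<inter> N \<and> \<bar>t\<bar> < \<epsilon>" by eventually_elim auto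
  then obtain r where r: "r > 0" "\<And>t. \<bar>t\<bar> < r \<Longrightarrow> A (c t) \<in> S \<inter> N \<and> \<bar>t\<bar> < \<epsilon>"
    by (auto simp: eventually_nhds_metric)
  let ?I = "{-r<..<r}"
  have I: "A (c t) \<in> S" "A (c t) \<in> N" "\<bar>t\<bar> < \<epsilon>" if "t \<in> ?I" for t using r(2)[of t] that by auto
  define g where "g = (\<lambda>t. \<tau> (A (c t)))"
  have cg: "c (g t) = A (c t)" if "t \<in> ?I" for t
    using c_\<tau> I[OF that] by (simp add: g_def)
  have "continuous_on ?I c" by (rule continuous_on_subset[OF cont_c]) (use I in fastforce)
  then have "continuous_on ?I (\<lambda>t. A (c t))" by (rule bounded_linear.continuous_on[OF A])
  then have "continuous_on ?I g" unfolding g_def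
    by (rule continuous_on_compose2[OF cont_\<tau>]) (use I in auto)
  moreover have "inj_on g ?I"
  proof (rule inj_onI)
    fix s t assume st: "s \<in> ?I" "t \<in> ?I" "g s = g t"
    then have "A (c s) = A (c t)" using cg by metis
    then have "c s = c t" using BA by metis
    then show "s = t" using \<tau>_c I(3) st by metis
  qed
  ultimately have "open (g ` ?I)"
    by (intro injective_into_1d_imp_open_map_UNIV[where S="?I"]) auto
  moreover have "0 \<in> g ` ?I"
    using r(1) by (intro image_eqI[of _ _ 0]) (auto simp: g_def c_0 A0 \<tau>_0)
  ultimately have "\<forall>\<^sub>F s in nhds 0. s \<in> g ` ?I" by (rule eventually_nhds_in_open)
  then have "\<forall>\<^sub>F p in nhds 0. \<tau> p \<in> g ` ?I" using tendsto_\<tau> unfolding filterlim_iff by blast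
  moreover have "\<forall>\<^sub>F p in nhds 0. p \<in> N" using N by (simp add: eventually_nhds_in_open)
  ultimately show ?thesis
  proof eventually_elim
    case (elim p)
    show ?case
    proof
      assume "p \<in> S"
      then have "c (\<tau> p) = p" using c_\<tau> elim by blast
      moreover obtain t where t: "t \<in> ?I" "\<tau> p = g t" using elim by blast
      ultimately have "p = A (c t)" using cg by simp
      then show "B p \<in> S" using BA c_in I(3)[OF t(1)] by simp
    qed
  qed
qed

context
  fixes \<xi> :: "'a \<Rightarrow> real"
  assumes \<xi>: "bounded_linear \<xi>" and \<xi>v: "\<xi> v \<noteq> 0"
begin

text \<open>The error O(t^2) is eventually at most half of the main term. The remaining half yields
  the lower bound \<open>parameter_le\<close> and locates the end values in
  \<open>\<xi>_locally_onto\<close>.\<close>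

lemma \<xi>_near: "\<forall>\<^sub>F t in nhds 0. \<bar>\<xi> (c t) - t * \<xi> v\<bar> \<le> \<bar>\<xi> v\<bar> * \<bar>t\<bar> / 2"
proof -
  obtain C where C: "C \<ge> 0" "\<forall>\<^sub>F t in nhds 0. norm (\<xi> (c t) - t *\<^sub>R \<xi> v) \<le> C * t ^ 2"
    using linear_approx[OF \<xi>] .
  have "\<bar>\<xi> v\<bar> / (2 * (C + 1)) > 0" using \<xi>v C by simp
  from C(2) ev_t[OF this] show ?thesis
  proof eventually_elim
    case (elim t)
    have "\<bar>t\<bar> * (C + 1) \<le> \<bar>\<xi> v\<bar> / 2" using elim C(1) by (simp add: field_simps)
    then have "C * \<bar>t\<bar> \<le> \<bar>\<xi> v\<bar> / 2" by (simp add: algebra_simps)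
    then have "(C * \<bar>t\<bar>) * \<bar>t\<bar> \<le> (\<bar>\<xi> v\<bar> / 2) * \<bar>t\<bar>" by (rule mult_right_mono) simp
    then show ?case using elim by (simp add: power2_eq_square mult.assoc)
  qed
qed

lemma parameter_le: "\<forall>\<^sub>F t in nhds 0. \<bar>t\<bar> \<le> 2 / \<bar>\<xi> v\<bar> * \<bar>\<xi> (c t)\<bar>"
  using \<xi>_near
proof eventually_elim
  case (elim t)
  have "\<bar>t * \<xi> v\<bar> = \<bar>\<xi> v\<bar> * \<bar>t\<bar>" by (simp add: abs_mult)
  with elim have "\<bar>\<xi> v\<bar> * \<bar>t\<bar> / 2 \<le> \<bar>\<xi> (c t)\<bar>" by linarith
  then show ?case using \<xi>v by (simp add: field_simps)
qed

text \<open>As \<bar>t\<bar> is at most a multiple of \<bar>\<xi> (c t)\<bar>, an order in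
  \<open>t\<close> is an order in \<open>\<xi>\<close>.\<close>

lemma order_transfer:
  assumes "\<forall>\<^sub>F t in nhds 0. \<bar>h (c t)\<bar> \<le> C * \<bar>t\<bar> ^ n"
  shows "\<exists>C. \<forall>\<^sub>F p in nhds 0. p \<in> S \<longrightarrow> \<bar>h p\<bar> \<le> C * \<bar>\<xi> p\<bar> ^ n"
proof -
  have "\<forall>\<^sub>F t in nhds 0. \<bar>h (c t)\<bar> \<le> (\<bar>C\<bar> * (2 / \<bar>\<xi> v\<bar>) ^ n) * \<bar>\<xi> (c t)\<bar> ^ n"
    using assms parameter_le
  proof eventually_elim
    case (elim t)
    have "C * \<bar>t\<bar> ^ n \<le> \<bar>C\<bar> * (2 / \<bar>\<xi> v\<bar> * \<bar>\<xi> (c t)\<bar>) ^ n"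
      using elim by (intro mult_mono power_mono) auto
    also have "\<dots> = (\<bar>C\<bar> * (2 / \<bar>\<xi> v\<bar>) ^ n) * \<bar>\<xi> (c t)\<bar> ^ n"
      by (simp only: power_mult_distrib mult.assoc)
    finally show ?case using elim by linarith
  qed
  from eventually_on_curve[OF this] show ?thesis by blast
qed

lemma norm_le_\<xi>: "\<exists>K. \<forall>\<^sub>F p in nhds 0. p \<in> S \<longrightarrow> norm p \<le> K * \<bar>\<xi> p\<bar>"
proof -
  obtain C where "\<forall>\<^sub>F t in nhds 0. norm (c t) \<le> C * \<bar>t\<bar>"
    using norm_linear_along_curve_le[OF bounded_linear_ident] .
  then show ?thesis using order_transfer[of norm C 1] by simp
qed

lemma \<eta>_quadratic:
  assumes "bounded_linear \<eta>" "\<eta> v = 0"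
  shows "\<exists>M. \<forall>\<^sub>F p in nhds 0. p \<in> S \<longrightarrow> \<bar>\<eta> p\<bar> \<le> M * \<bar>\<xi> p\<bar> ^ 2"
proof -
  obtain C where "\<forall>\<^sub>F t in nhds 0. norm (\<eta> (c t) - t *\<^sub>R \<eta> v) \<le> C * t ^ 2"
    using linear_approx[OF assms(1)] .
  then show ?thesis using order_transfer[of \<eta> C 2] assms by simp
qed

lemma frequently_\<xi>_nonzero: "\<exists>\<^sub>F p in nhds 0. p \<in> S \<and> \<xi> p \<noteq> 0"
proof (rule ccontr)
  assume "\<not> ?thesis"
  then have "\<forall>\<^sub>F p in nhds 0. p \<in> S \<longrightarrow> \<xi> p = 0" by (simp add: frequently_def)
  \<comment> \<open>With \<open>\<xi>\<close> vanishing on the arc, all small \<open>t\<close> would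
    be 0; this is phrased as a bound with coefficient 1 so that
    \<open>coefficient_zero_if_higher_order\<close> refutes it.\<close>
  from eventually_along_curve[OF this] parameter_le
  have "\<forall>\<^sub>F t :: real in nhds 0. \<bar>1\<bar> * \<bar>t\<bar> ^ 1 \<le> 0 * \<bar>t\<bar> ^ Suc 1"
    by eventually_elim simp
  from coefficient_zero_if_higher_order[OF this] show False by simp
qed

text \<open>Intermediate value argument along the arc. It later shows that \<open>S\<close> fills
  its monomial curve near 0 and is not merely contained in it.\<close>

lemma \<xi>_locally_onto:
  assumes "\<forall>\<^sub>F p in nhds 0. P p"
  shows "\<forall>\<^sub>F x in nhds 0. \<exists>p \<in> S. P p \<and> \<xi> p = x"
proof -
  have "\<forall>\<^sub>F t in nhds 0. P (c t)" using tendsto_c assms unfolding filterlim_iff by blast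
  with \<xi>_near ev_t[OF \<epsilon>]
  have "\<forall>\<^sub>F t in nhds 0. P (c t) \<and> \<bar>t\<bar> < \<epsilon> \<and> \<bar>\<xi> (c t) - t * \<xi> v\<bar> \<le> \<bar>\<xi> v\<bar> * \<bar>t\<bar> / 2"
    by eventually_elim auto
  then obtain r where r: "r > 0" "\<And>t. \<bar>t\<bar> < r \<Longrightarrow> P (c t) \<and> \<bar>t\<bar> < \<epsilon> \<and> \<bar>\<xi> (c t) - t * \<xi> v\<bar> \<le> \<bar>\<xi> v\<bar> * \<bar>t\<bar> / 2"
    by (auto simp: eventually_nhds_metric)
  define s where "s = r / 2"
  have s: "s > 0" "s < r" using r by (auto simp: s_def)
  let ?J = "(\<lambda>t. \<xi> (c t)) ` {-s..s}"
  have "continuous_on {-s..s} c"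
    by (rule continuous_on_subset[OF cont_c]) (use r(2)[of s] s in auto)
  then have "continuous_on {-s..s} (\<lambda>t. \<xi> (c t))" by (rule bounded_linear.continuous_on[OF \<xi>])
  then have J: "connected ?J" by (intro connected_continuous_image) auto
  have in_J: "\<xi> (c s) \<in> ?J" "\<xi> (c (-s)) \<in> ?J" using s by auto
  \<comment> \<open>At the parameters \<open>s\<close> and \<open>-s\<close> the main term has size
    \<open>2 * m\<close> and the error is at most \<open>m\<close>, so the two end values enclose
    the interval from \<open>-m\<close> to \<open>m\<close>.\<close>
  define m where "m = s * \<bar>\<xi> v\<bar> / 2"
  have m: "m > 0" using s \<xi>v by (simp add: m_def)
  have near: "\<bar>\<xi> (c s) - s * \<xi> v\<bar> \<le> m" "\<bar>\<xi> (c (-s)) + s * \<xi> v\<bar> \<le> m"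
    using r(2)[of s] r(2)[of "-s"] s by (simp_all add: m_def mult_ac)
  have "{-m..m} \<subseteq> ?J"
  proof (cases "\<xi> v > 0")
    case True
    then have "s * \<xi> v = 2 * m" by (simp add: m_def)
    then have "{-m..m} \<subseteq> {\<xi> (c (-s))..\<xi> (c s)}" using near by auto
    then show ?thesis using connected_contains_Icc[OF J in_J(2,1)] by blast
  next
    case False
    then have "s * \<xi> v = - (2 * m)" by (simp add: m_def)
    then have "{-m..m} \<subseteq> {\<xi> (c s)..\<xi> (c (-s))}" using near by auto
    then show ?thesis using connected_contains_Icc[OF J in_J] by blast
  qed
  have *: "\<exists>p \<in> S. P p \<and> \<xi> p = x" if "\<bar>x\<bar> < m" for x
  proof -
    have "x \<in> ?J" by (rule subsetD[OF \<open>{-m..m} \<subseteq> ?J\<close>]) (use that in auto)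
    then obtain t where "t \<in> {-s..s}" and x: "x = \<xi> (c t)" by blast
    then have t: "\<bar>t\<bar> \<le> s" by auto
    then show ?thesis using r(2)[of t] s c_in x by (intro bexI[of _ "c t"]) auto
  qed
  from ev_t[OF m] show ?thesis by eventually_elim (rule *)
qed

text \<open>If the bound of some order \<open>n\<close> fails for every constant, the Taylor
  polynomial of \<open>\<eta> (c t)\<close> below degree \<open>n\<close> is not zero. Its lowest
  term is the leading monomial, first in \<open>t\<close> and then, up to higher order, in
  \<open>\<xi>\<close>.\<close>

lemma flat_or_finite_order:
  assumes \<eta>: "bounded_linear \<eta>" "\<eta> v = 0"
  shows "(\<forall>n. \<exists>C. \<forall>\<^sub>F p in nhds 0. p \<in> S \<longrightarrow> \<bar>\<eta> p\<bar> \<le> C * \<bar>\<xi> p\<bar> ^ n) \<or>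
      (\<exists>k \<alpha> C. k \<ge> 2 \<and> \<alpha> \<noteq> 0 \<and>
        (\<forall>\<^sub>F p in nhds 0. p \<in> S \<longrightarrow> \<bar>\<eta> p - \<alpha> * \<xi> p ^ k\<bar> \<le> C * \<bar>\<xi> p\<bar> ^ Suc k))"
proof (cases "\<forall>n. \<exists>C. \<forall>\<^sub>F t in nhds 0. \<bar>\<eta> (c t)\<bar> \<le> C * \<bar>t\<bar> ^ n")
  case True
  then show ?thesis using order_transfer[of \<eta>] by blast
next
  case False
  then obtain n where n: "\<And>C. \<not> (\<forall>\<^sub>F t in nhds 0. \<bar>\<eta> (c t)\<bar> \<le> C * \<bar>t\<bar> ^ n)" by blast
  interpret \<eta>: bounded_linear \<eta> by fact
  obtain a C where aC: "\<forall>\<^sub>F t in nhds 0. norm (c t - (\<Sum>i<n. t ^ i *\<^sub>R a i)) \<le> C * \<bar>t\<bar> ^ n"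
    using Taylor by blast
  obtain K where K: "K > 0" "\<And>x. norm (\<eta> x) \<le> norm x * K" using \<eta>.pos_bounded by blast
  define b where "b = (\<lambda>i. \<eta> (a i))"
  have b: "\<forall>\<^sub>F t in nhds 0. \<bar>\<eta> (c t) - (\<Sum>i<n. b i * t ^ i)\<bar> \<le> (\<bar>C\<bar> * K) * \<bar>t\<bar> ^ n"
    using aC
  proof eventually_elim
    case (elim t)
    have "\<bar>\<eta> (c t) - (\<Sum>i<n. b i * t ^ i)\<bar> \<le> norm (c t - (\<Sum>i<n. t ^ i *\<^sub>R a i)) * K"
      using K(2)[of "c t - (\<Sum>i<n. t ^ i *\<^sub>R a i)"]
      by (simp add: \<eta>.diff \<eta>.sum \<eta>.scale b_def mult.commute)
    also have "\<dots> \<le> (\<bar>C\<bar> * \<bar>t\<bar> ^ n) * K"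
      using K(1) by (intro mult_right_mono order_trans[OF elim]) auto
    finally show ?case by (simp add: mult_ac)
  qed
  have "\<exists>i<n. b i \<noteq> 0"
  proof (rule ccontr)
    assume "\<not> ?thesis"
    then have "(\<Sum>i<n. b i * t ^ i) = 0" for t by (intro sum.neutral) auto
    then show False using b n by simp
  qed
  define k where "k = (LEAST i. b i \<noteq> 0)"
  have k: "b k \<noteq> 0" "\<And>i. i < k \<Longrightarrow> b i = 0" "k < n"
  proof -
    obtain i where i: "i < n" "b i \<noteq> 0" using \<open>\<exists>i<n. b i \<noteq> 0\<close> by blast
    show "b k \<noteq> 0" unfolding k_def by (rule LeastI[of "\<lambda>i. b i \<noteq> 0"]) (rule i)
    show "b i = 0" if "i < k" for i using that not_less_Least unfolding k_def by blast
    have "k \<le> i" unfolding k_def using i by (intro Least_le)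
    then show "k < n" using i by simp
  qed
  \<comment> \<open>For \<bar>t\<bar> < 1 the Taylor remainder and all terms of index above
    \<open>k\<close> are absorbed into \<bar>t\<bar>^(k+1).\<close>
  define R where "R = \<bar>C\<bar> * K + (\<Sum>i\<in>{k<..<n}. \<bar>b i\<bar>)"
  have lead: "\<forall>\<^sub>F t in nhds 0. \<bar>\<eta> (c t) - b k * t ^ k\<bar> \<le> R * \<bar>t\<bar> ^ Suc k"
    using b ev_t[OF zero_less_one]
  proof eventually_elim
    case (elim t)
    have "{..<n} = {..<k} \<union> insert k {k<..<n}" using k(3) by auto
    moreover have "{..<k} \<inter> insert k {k<..<n} = {}" by auto
    ultimately have "(\<Sum>i<n. b i * t ^ i) = (\<Sum>i<k. b i * t ^ i) + (b k * t ^ k + (\<Sum>i\<in>{k<..<n}. b i * t ^ i))"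
      by (simp add: sum.union_disjoint del: Un_insert_right)
    moreover have "(\<Sum>i<k. b i * t ^ i) = 0" using k(2) by simp
    moreover have "\<bar>\<Sum>i\<in>{k<..<n}. b i * t ^ i\<bar> \<le> (\<Sum>i\<in>{k<..<n}. \<bar>b i\<bar>) * \<bar>t\<bar> ^ Suc k"
      unfolding sum_distrib_right
    proof (rule order_trans[OF sum_abs], rule sum_mono)
      fix i assume "i \<in> {k<..<n}"
      then have "\<bar>t\<bar> ^ i \<le> \<bar>t\<bar> ^ Suc k" using elim by (intro power_decreasing) auto
      then show "\<bar>b i * t ^ i\<bar> \<le> \<bar>b i\<bar> * \<bar>t\<bar> ^ Suc k"
        unfolding abs_mult power_abs by (rule mult_left_mono) simp
    qed
    moreover have "(\<bar>C\<bar> * K) * \<bar>t\<bar> ^ n \<le> (\<bar>C\<bar> * K) * \<bar>t\<bar> ^ Suc k"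
      using elim k(3) K(1) by (intro mult_left_mono power_decreasing) auto
    ultimately show ?case using elim unfolding R_def distrib_right by linarith
  qed
  obtain C2 where C2: "C2 \<ge> 0" "\<forall>\<^sub>F t in nhds 0. norm (\<eta> (c t) - t *\<^sub>R \<eta> v) \<le> C2 * t ^ 2"
    using linear_approx[OF \<eta>(1)] .
  have "k \<ge> 2"
  proof (rule ccontr)
    \<comment> \<open>As \<open>\<eta> v = 0\<close>, \<open>\<eta> (c t)\<close> is O(t^2), which
      for k < 2 is at least of order k+1; then the leading coefficient \<open>b k\<close> would
      vanish.\<close>
    assume "\<not> k \<ge> 2"
    have "\<forall>\<^sub>F t in nhds 0. \<bar>b k\<bar> * \<bar>t\<bar> ^ k \<le> (R + C2) * \<bar>t\<bar> ^ Suc k"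
      using lead C2(2) ev_t[OF zero_less_one]
    proof eventually_elim
      case (elim t)
      have "\<bar>t\<bar> ^ 2 \<le> \<bar>t\<bar> ^ Suc k" using elim \<open>\<not> k \<ge> 2\<close> by (intro power_decreasing) auto
      then have "C2 * \<bar>t\<bar> ^ 2 \<le> C2 * \<bar>t\<bar> ^ Suc k" using C2(1) by (rule mult_left_mono)
      then have "\<bar>\<eta> (c t)\<bar> \<le> C2 * \<bar>t\<bar> ^ Suc k" using elim \<eta>(2) by simp
      then have "\<bar>b k * t ^ k\<bar> \<le> (R + C2) * \<bar>t\<bar> ^ Suc k"
        using elim unfolding distrib_right by linarith
      then show ?case by (simp add: abs_mult power_abs)
    qed
    then show False using k(1) coefficient_zero_if_higher_order by blast
  qed
  \<comment> \<open>To first order \<open>t\<close> is \<open>\<xi> (c t) / \<xi> v\<close>, which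
    rescales the leading coefficient.\<close>
  define \<alpha> where "\<alpha> = b k / \<xi> v ^ k"
  obtain C3 where C3: "C3 \<ge> 0" "\<forall>\<^sub>F t in nhds 0. norm (\<xi> (c t) - t *\<^sub>R \<xi> v) \<le> C3 * t ^ 2"
    using linear_approx[OF \<xi>] .
  obtain D where D: "D \<ge> 0" "\<forall>\<^sub>F t in nhds 0. norm (\<xi> (c t)) \<le> D * \<bar>t\<bar>"
    using norm_linear_along_curve_le[OF \<xi>] .
  \<comment> \<open>\<open>D + \<bar>\<xi> v\<bar>\<close> is a common bound for
    \<open>\<xi> (c t)\<close> and for its linear part, relative to \<bar>t\<bar>.\<close>
  obtain E where E: "\<And>x y t. \<bar>x - y\<bar> \<le> C3 * t ^ 2 \<Longrightarrow> \<bar>x\<bar> \<le> (D + \<bar>\<xi> v\<bar>) * \<bar>t\<bar> \<Longrightarrow>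
      \<bar>y\<bar> \<le> (D + \<bar>\<xi> v\<bar>) * \<bar>t\<bar> \<Longrightarrow> \<bar>x ^ k - y ^ k\<bar> \<le> E * \<bar>t\<bar> ^ Suc k"
    using abs_power_diff_le[of C3 "D + \<bar>\<xi> v\<bar>" k] by blast
  have "\<forall>\<^sub>F t in nhds 0. \<bar>\<eta> (c t) - \<alpha> * \<xi> (c t) ^ k\<bar> \<le> (R + \<bar>\<alpha>\<bar> * E) * \<bar>t\<bar> ^ Suc k"
    using lead C3(2) D(2)
  proof eventually_elim
    case (elim t)
    have "\<bar>\<xi> (c t) ^ k - (t * \<xi> v) ^ k\<bar> \<le> E * \<bar>t\<bar> ^ Suc k"
      using elim D(1) by (intro E) (auto simp: algebra_simps abs_mult intro: add_increasing2)
    then have "\<bar>\<alpha> * (\<xi> (c t) ^ k - (t * \<xi> v) ^ k)\<bar> \<le> \<bar>\<alpha>\<bar> * E * \<bar>t\<bar> ^ Suc k"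
      unfolding abs_mult mult.assoc by (rule mult_left_mono) simp
    moreover have "\<alpha> * (t * \<xi> v) ^ k = b k * t ^ k"
      using \<xi>v by (simp add: \<alpha>_def power_mult_distrib)
    ultimately show ?case using elim unfolding distrib_right right_diff_distrib by linarith
  qed
  from order_transfer[OF this] have "\<exists>C. \<forall>\<^sub>F p in nhds 0. p \<in> S \<longrightarrow> \<bar>\<eta> p - \<alpha> * \<xi> p ^ k\<bar> \<le> C * \<bar>\<xi> p\<bar> ^ Suc k" .
  moreover have "\<alpha> \<noteq> 0" using k(1) \<xi>v by (simp add: \<alpha>_def)
  ultimately show ?thesis using \<open>k \<ge> 2\<close> by blast
qed

end

end

text \<open>A straightening chart sends \<open>S\<close> near 0 to a piece of the first axis: the
  inverse chart along this axis is the parametrization, and the first chart coordinate, measured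
  from \<open>\<phi> 0\<close>, recovers the parameter.\<close>

lemma smooth_curve_parametrization:
  assumes "smooth_curve_around_0 S"
  obtains N c \<tau> \<epsilon> v where "parametrized_curve S N c \<tau> \<epsilon> v"
proof -
  from assms obtain V U \<phi> where S0: "0 \<in> S" and U: "0 \<in> U" "diffeo_on smooth_on U \<phi>"
    and img: "\<phi> ` (S \<inter> U) = \<phi> ` U \<inter> {y. y$2 = 0}"
    unfolding smooth_curve_around_0_def closed_curve_in_def by blast
  then obtain \<psi> where oU: "open U" and oW: "open (\<phi> ` U)" and \<phi>: "smooth_on \<phi> U" and \<psi>: "smooth_on \<psi> (\<phi> ` U)"
    and \<psi>\<phi>: "\<And>x. x \<in> U \<Longrightarrow> \<psi> (\<phi> x) = x"
    by (auto simp: diffeo_on_def)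
  have cont_\<phi>: "continuous_on U \<phi>" and cont_\<psi>: "continuous_on (\<phi> ` U) \<psi>"
    using \<phi> \<psi> by (metis smooth_on_def Ck_on.simps(1))+
  \<comment> \<open>The chart condition concerns images only; injectivity of \<open>\<phi>\<close>
    on \<open>U\<close>, provided by \<open>\<psi>\<close>, makes it a pointwise test.\<close>
  have mem: "p \<in> S \<longleftrightarrow> \<phi> p $ 2 = 0" if "p \<in> U" for p
  proof
    assume "\<phi> p $ 2 = 0"
    then have "\<phi> p \<in> \<phi> ` (S \<inter> U)" unfolding img using that by blast
    then obtain x where x: "x \<in> S" "x \<in> U" "\<phi> p = \<phi> x" by blast
    then have "p = x" using \<psi>\<phi>[OF \<open>x \<in> U\<close>] \<psi>\<phi>[OF that] by metis
    then show "p \<in> S" using x by simp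
  next
    assume "p \<in> S"
    then have "\<phi> p \<in> \<phi> ` (S \<inter> U)" using that by blast
    then show "\<phi> p $ 2 = 0" unfolding img by blast
  qed
  define q where "q = \<phi> 0"
  have q: "q \<in> \<phi> ` U" "q $ 2 = 0" using U(1) mem[OF U(1)] S0 by (simp_all add: q_def)
  obtain \<epsilon> where \<epsilon>: "\<epsilon> > 0" "ball q \<epsilon> \<subseteq> \<phi> ` U" using oW q open_contains_ball by blast
  define e where "e = (axis 1 1 :: real^2)"
  define c where "c = (\<lambda>t. \<psi> (q + t *\<^sub>R e))"
  define \<tau> where "\<tau> = (\<lambda>p. \<phi> p $ 1 - q $ 1)"
  \<comment> \<open>The ball keeps the recovered parameter below \<open>\<epsilon>\<close> in
    absolute value.\<close>
  define N where "N = {p \<in> U. \<phi> p \<in> ball q \<epsilon>}"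
  have ne: "norm e = 1" by (simp add: e_def)
  have inW: "q + t *\<^sub>R e \<in> \<phi> ` U" if "\<bar>t\<bar> < \<epsilon>" for t
    using that \<epsilon>(2) ne by (auto simp: dist_norm)
  have \<phi>c: "c t \<in> U \<and> \<phi> (c t) = q + t *\<^sub>R e" if "\<bar>t\<bar> < \<epsilon>" for t
    using inW[OF that] \<psi>\<phi> by (auto simp: c_def)
  have \<tau>_c: "\<tau> (c t) = t" if "\<bar>t\<bar> < \<epsilon>" for t
    using \<phi>c[OF that] by (simp add: \<tau>_def e_def)
  have Taylor: "\<exists>a C. \<forall>\<^sub>F t in nhds 0. norm (c t - (\<Sum>i<n. t ^ i *\<^sub>R a i)) \<le> C * \<bar>t\<bar> ^ n" for n
    unfolding c_def using \<psi> oW q by (intro Ck_on_directional_Taylor) (auto simp: smooth_on_def)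
  have c0: "c 0 = 0" using \<psi>\<phi>[OF U(1)] by (simp add: c_def q_def)
  obtain a C where aC: "\<forall>\<^sub>F t in nhds 0. norm (c t - (\<Sum>i<2. t ^ i *\<^sub>R a i)) \<le> C * \<bar>t\<bar> ^ 2"
    using Taylor by blast
  \<comment> \<open>The estimate holds at t = 0 itself, where its right-hand side vanishes.\<close>
  have "a 0 = 0" using eventually_nhds_x_imp_x[OF aC] by (simp add: c0 numeral_2_eq_2)
  then have approx: "\<forall>\<^sub>F t in nhds 0. norm (c t - t *\<^sub>R a 1) \<le> C * t ^ 2"
    using aC by (simp add: numeral_2_eq_2)
  \<comment> \<open>Otherwise \<open>c t\<close> is O(t^2), and differentiability of
    \<open>\<phi>\<close> at 0 would make \<bar>t\<bar>, the norm of
    \<open>\<phi> (c t) - \<phi> 0\<close>, of order t^2 as well.\<close>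
  have "a 1 \<noteq> 0"
  proof
    assume a1: "a 1 = 0"
    have "Ck_on (Suc 0) \<phi> U" using \<phi> by (simp only: smooth_on_def)
    then obtain \<phi>' where "(\<phi> has_derivative \<phi>') (at 0)" using U(1) by auto
    then obtain d where bl: "bounded_linear \<phi>'" and d: "d > 0" "\<And>y. norm y < d \<Longrightarrow> norm (\<phi> y - \<phi> 0 - \<phi>' y) \<le> norm y"
      unfolding has_derivative_at_alt by (metis diff_zero mult_1 zero_less_one)
    obtain K where K: "K > 0" "\<And>x. norm (\<phi>' x) \<le> norm x * K" using bounded_linear.pos_bounded[OF bl] by blast
    have "isCont \<psi> q" using continuous_on_eq_continuous_at[OF oW] cont_\<psi> q(1) by blast
    then have "isCont c 0" unfolding c_def
      using isCont_o2[of 0 "\<lambda>t. q + t *\<^sub>R e" \<psi>] by simp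
    then have "(c \<longlongrightarrow> 0) (nhds 0)"
      using tendsto_at_iff_tendsto_nhds[of c 0] by (simp add: isCont_def c0)
    then have "\<forall>\<^sub>F t in nhds 0. norm (c t) < d"
      using d(1) by (intro order_tendstoD(2)[where y="0::real"] tendsto_norm_zero) auto
    moreover have "\<forall>\<^sub>F t::real in nhds 0. \<bar>t\<bar> < \<epsilon>" using \<epsilon>(1) by (auto simp: eventually_nhds_metric)
    ultimately have "\<forall>\<^sub>F t in nhds 0. \<bar>1\<bar> * \<bar>t\<bar> ^ 1 \<le> ((1 + K) * C) * \<bar>t\<bar> ^ Suc 1"
      using approx
    proof eventually_elim
      case (elim t)
      have "norm (\<phi> (c t) - \<phi> 0) \<le> norm (\<phi> (c t) - \<phi> 0 - \<phi>' (c t)) + norm (\<phi>' (c t))"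
        using norm_triangle_ineq[of "\<phi> (c t) - \<phi> 0 - \<phi>' (c t)" "\<phi>' (c t)"] by simp
      also have "\<dots> \<le> (1 + K) * norm (c t)" using d(2)[of "c t"] K(2)[of "c t"] elim by (simp add: algebra_simps)
      also have "\<dots> \<le> (1 + K) * (C * t ^ 2)" using elim a1 K(1) by (intro mult_left_mono) auto
      also have "norm (\<phi> (c t) - \<phi> 0) = \<bar>t\<bar>" using \<phi>c[of t] elim ne by (simp add: q_def)
      finally show ?case by (simp add: mult.assoc power2_eq_square)
    qed
    from coefficient_zero_if_higher_order[OF this] show False by simp
  qed
  have "parametrized_curve S N c \<tau> \<epsilon> (a 1)"
  proof
    have "N = U \<inter> \<phi> -` ball q \<epsilon>" by (auto simp: N_def)
    then show "open N" using continuous_open_preimage[OF cont_\<phi> oU] by auto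
    show "0 \<in> N" using U(1) \<epsilon>(1) by (simp add: N_def q_def)
    show "continuous_on {-\<epsilon><..<\<epsilon>} c" unfolding c_def
      by (rule continuous_on_compose2[OF cont_\<psi>]) (use inW in \<open>auto intro!: continuous_intros\<close>)
    have "continuous_on N \<phi>" using cont_\<phi> by (rule continuous_on_subset) (auto simp: N_def)
    then show "continuous_on N \<tau>" unfolding \<tau>_def by (intro continuous_intros)
    show "c t \<in> S" if "\<bar>t\<bar> < \<epsilon>" for t
      using \<phi>c[OF that] mem q(2) by (simp add: e_def axis_def)
    show "\<bar>\<tau> p\<bar> < \<epsilon> \<and> c (\<tau> p) = p" if "p \<in> S" "p \<in> N" for p
    proof
      have p: "p \<in> U" "\<phi> p \<in> ball q \<epsilon>" using that by (auto simp: N_def)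
      have "\<bar>(\<phi> p - q) $ 1\<bar> \<le> norm (\<phi> p - q)" by (rule component_le_norm_cart)
      then show "\<bar>\<tau> p\<bar> < \<epsilon>" using p by (simp add: \<tau>_def dist_norm norm_minus_commute)
      have "\<phi> p $ 2 = 0" using mem p that by simp
      then have "q + \<tau> p *\<^sub>R e = \<phi> p" using q(2) by (simp add: vec_eq_iff forall_2 \<tau>_def e_def axis_def)
      then show "c (\<tau> p) = p" using \<psi>\<phi> p by (simp add: c_def)
    qed
  qed (use \<epsilon> c0 \<tau>_c Taylor approx \<open>a 1 \<noteq> 0\<close> in auto)
  then show ?thesis by (rule that)
qed

section \<open>Polynomial maps and monomial curves\<close>

text \<open>\<open>Q\<close> is a polynomial in \<open>x$1 - p$1\<close> whose coefficients are
  polynomials in \<open>x$2 - p$2\<close>; so \<open>coeff (coeff Q i) j\<close> is the power series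
  coefficient at \<open>p\<close> that \<open>real_analytic_on\<close> asks for.\<close>

lemma real_polynomial_function_poly_poly:
  fixes f :: "real^2 \<Rightarrow> real" and p :: "real^2"
  assumes "real_polynomial_function f"
  shows "\<exists>Q :: real poly poly. \<forall>x. f x = poly (poly Q [:x$1 - p$1:]) (x$2 - p$2)"
  using assms
proof induction
  case (linear f)
  interpret bounded_linear f by fact
  have "f x = f p + (x$1 - p$1) * f (axis 1 1) + (x$2 - p$2) * f (axis 2 1)" for x
  proof -
    have "x - p = (x$1 - p$1) *\<^sub>R axis 1 1 + (x$2 - p$2) *\<^sub>R axis 2 1"
      by (simp add: vec_eq_iff forall_2 axis_def)
    then have "f (x - p) = (x$1 - p$1) * f (axis 1 1) + (x$2 - p$2) * f (axis 2 1)"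
      by (simp add: add scale)
    then show ?thesis by (simp add: diff)
  qed
  then show ?case
    by (intro exI[of _ "[:[:f p, f (axis 2 1):], [:f (axis 1 1):]:]"]) (simp add: algebra_simps)
next
  case (const c)
  show ?case by (intro exI[of _ "[:[:c:]:]"]) simp
next
  case (add f g)
  then obtain P Q where "\<forall>x. f x = poly (poly P [:x$1 - p$1:]) (x$2 - p$2)"
    "\<forall>x. g x = poly (poly Q [:x$1 - p$1:]) (x$2 - p$2)" by blast
  then show ?case by (intro exI[of _ "P + Q"]) simp
next
  case (mult f g)
  then obtain P Q where "\<forall>x. f x = poly (poly P [:x$1 - p$1:]) (x$2 - p$2)"
    "\<forall>x. g x = poly (poly Q [:x$1 - p$1:]) (x$2 - p$2)" by blast
  then show ?case by (intro exI[of _ "P * Q"]) simp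
qed

text \<open>All coefficients beyond the degrees vanish, so a finite sum is already the sum over all
  index pairs.\<close>

lemma has_sum_poly_poly:
  fixes Q :: "real poly poly"
  shows "((\<lambda>(i, j). u ^ i * v ^ j * coeff (coeff Q i) j) has_sum poly (poly Q [:u:]) v) UNIV"
proof -
  let ?F = "SIGMA i:{..degree Q}. {..degree (coeff Q i)}"
  let ?f = "\<lambda>(i, j). u ^ i * v ^ j * coeff (coeff Q i) j"
  have pw: "[:u:] ^ i = [:u ^ i:]" for i by (induction i) auto
  have "poly (poly Q [:u:]) v = (\<Sum>i\<le>degree Q. u ^ i * poly (coeff Q i) v)"
    by (simp add: poly_altdef[of Q "[:u:]"] poly_sum pw)
  also have "\<dots> = (\<Sum>i\<le>degree Q. \<Sum>j\<le>degree (coeff Q i). u ^ i * v ^ j * coeff (coeff Q i) j)"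
    by (intro sum.cong refl) (simp only: poly_altdef sum_distrib_left mult.assoc mult.commute[of "coeff _ _"])
  also have "\<dots> = sum ?f ?F" by (simp add: sum.Sigma)
  finally have eq: "poly (poly Q [:u:]) v = sum ?f ?F" .
  have "finite ?F" by simp
  then have "(?f has_sum poly (poly Q [:u:]) v) ?F" unfolding eq by (rule has_sum_finite)
  moreover have "(?f has_sum poly (poly Q [:u:]) v) ?F \<longleftrightarrow> (?f has_sum poly (poly Q [:u:]) v) UNIV"
  proof (rule has_sum_cong_neutral)
    fix x assume "x \<in> UNIV - ?F"
    then obtain i j where x: "x = (i, j)" "i \<le> degree Q \<Longrightarrow> degree (coeff Q i) < j"
      by (cases x) (auto simp: not_le)
    show "?f x = 0"
    proof (cases "i \<le> degree Q")
      case True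
      then show ?thesis using x coeff_eq_0[of "coeff Q i" j] by simp
    next
      case False
      then show ?thesis using x coeff_eq_0[of Q i] by simp
    qed
  qed simp_all
  ultimately show ?thesis by simp
qed

lemma polynomial_map_real_analytic:
  fixes f :: "real^2 \<Rightarrow> real^2"
  assumes f: "\<And>l. real_polynomial_function (\<lambda>x. f x $ l)"
  shows "real_analytic_on f U"
  unfolding real_analytic_on_def
proof
  fix p assume "p \<in> U"
  obtain Q :: "2 \<Rightarrow> real poly poly" where Q: "\<And>l x. f x $ l = poly (poly (Q l) [:x$1 - p$1:]) (x$2 - p$2)"
    using real_polynomial_function_poly_poly[OF f, where p = p] by metis
  let ?a = "\<lambda>i j. (\<chi> l. coeff (coeff (Q l) i) j) :: real^2"
  have "((\<lambda>(i, j). ((x$1 - p$1) ^ i * (x$2 - p$2) ^ j) *\<^sub>R ?a i j) has_sum f x) UNIV" for x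
    unfolding has_sum_def
  proof (rule vec_tendstoI)
    fix l
    show "((\<lambda>F. sum (\<lambda>(i, j). ((x$1 - p$1) ^ i * (x$2 - p$2) ^ j) *\<^sub>R ?a i j) F $ l) \<longlongrightarrow> f x $ l)
        (finite_subsets_at_top UNIV)"
      using has_sum_poly_poly[of "x$1 - p$1" "x$2 - p$2" "Q l"]
      by (simp add: has_sum_def Q case_prod_beta' sum_component)
  qed
  then show "\<exists>a r. r > 0 \<and> (\<forall>x\<in>ball p r.
      ((\<lambda>(i, j). ((x$1 - p$1) ^ i * (x$2 - p$2) ^ j) *\<^sub>R a i j) has_sum f x) UNIV)"
    \<comment> \<open>The expansion is finite and valid everywhere, so the radius 1 is
      arbitrary.\<close>
    by (intro exI[of _ ?a] exI[of _ 1]) auto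
qed

text \<open>The map with coordinates \<xi> and \<eta> - \<alpha> \<xi>^k is a polynomial bijection
  of the plane with polynomial inverse, hence a single analytic chart straightening the whole
  curve.\<close>

lemma monomial_curve_analytic_algebraic:
  fixes \<xi> \<eta> :: "real^2 \<Rightarrow> real"
  assumes lin: "bounded_linear \<xi>" "bounded_linear \<eta>" and coord: "\<And>p. p = \<xi> p *\<^sub>R e + \<eta> p *\<^sub>R f"
    and dual: "\<xi> e = 1" "\<eta> e = 0" "\<xi> f = 0" "\<eta> f = 1"
    and U: "open U" and S: "S = {p \<in> U. \<eta> p = \<alpha> * \<xi> p ^ k}"
  shows "closed_curve_in real_analytic_on U S" "real_algebraic_in U S"
proof -
  interpret \<xi>: bounded_linear \<xi> by fact
  interpret \<eta>: bounded_linear \<eta> by fact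
  define P where "P = (\<lambda>p. \<eta> p - \<alpha> * \<xi> p ^ k)"
  have P: "real_polynomial_function P" unfolding P_def
    by (intro real_polynomial_function_diff real_polynomial_function.intros real_polynomial_function_power lin)
  have S_eq: "S = {p \<in> U. P p = 0}" by (auto simp: S P_def)
  \<comment> \<open>Taking the difference cancels \<alpha> 0^k, which equals \<alpha> for k = 0; so
    \<open>P\<close> is not identically zero, whatever \<open>k\<close> is.\<close>
  have "P f - P 0 = 1" by (simp add: P_def dual)
  then have "\<exists>x. P x \<noteq> 0" by (metis diff_zero zero_neq_one)
  then show "real_algebraic_in U S" using P S_eq by (auto simp: real_algebraic_in_def)
  define \<Phi> where "\<Phi> = (\<lambda>p. \<chi> l::2. if l = 1 then \<xi> p else P p)"
  define \<Psi> where "\<Psi> = (\<lambda>q::real^2. q$1 *\<^sub>R e + (q$2 + \<alpha> * q$1 ^ k) *\<^sub>R f)"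
  have \<Psi>\<Phi>: "\<Psi> (\<Phi> p) = p" for p
    using coord[of p, symmetric] by (simp add: \<Psi>_def \<Phi>_def P_def)
  have \<Phi>\<Psi>: "\<Phi> (\<Psi> q) = q" for q
    by (simp add: \<Psi>_def \<Phi>_def P_def vec_eq_iff forall_2 dual \<xi>.add \<xi>.scale \<eta>.add \<eta>.scale)
  have comp: "bounded_linear (\<lambda>x::real^2. x $ i)" for i by (rule bounded_linear_vec_nth)
  have \<Phi>_an: "real_analytic_on \<Phi> V" for V
  proof (rule polynomial_map_real_analytic)
    fix l :: 2
    show "real_polynomial_function (\<lambda>x. \<Phi> x $ l)"
      by (cases "l = 1") (use P lin in \<open>auto simp: \<Phi>_def\<close>)
  qed
  have \<Psi>_an: "real_analytic_on \<Psi> V" for V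
  proof (rule polynomial_map_real_analytic)
    fix l :: 2
    have "real_polynomial_function (\<lambda>q :: real^2. q$1 * e$l + (q$2 + \<alpha> * q$1 ^ k) * f$l)"
      by (intro real_polynomial_function.intros(2-4) real_polynomial_function_power
          real_polynomial_function.intros(1)[OF comp])
    then show "real_polynomial_function (\<lambda>x. \<Psi> x $ l)" by (simp add: \<Psi>_def)
  qed
  have "continuous_on UNIV \<Psi>" unfolding \<Psi>_def by (intro continuous_intros)
  then have "open (\<Psi> -` U)" using U by (simp add: open_vimage)
  also have "\<Psi> -` U = \<Phi> ` U"
  proof safe
    fix q assume "\<Psi> q \<in> U"
    then show "q \<in> \<Phi> ` U" using \<Phi>\<Psi>[of q] by (metis imageI)
  qed (simp add: \<Psi>\<Phi>)
  finally have "diffeo_on real_analytic_on U \<Phi>"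
    using U \<Phi>_an \<Psi>_an \<Psi>\<Phi> by (auto simp: diffeo_on_def)
  moreover have "\<Phi> ` (S \<inter> U) = \<Phi> ` U \<inter> {y. y$2 = 0}"
    by (auto simp: S_eq \<Phi>_def)
  moreover have "closedin (top_of_set U) S"
  proof -
    have "continuous_on U P" using P by (simp add: continuous_on_polymonial_function real_polynomial_function_eq)
    from continuous_closedin_preimage_constant[OF this, of 0] show ?thesis by (simp add: S_eq)
  qed
  ultimately show "closed_curve_in real_analytic_on U S"
    using U unfolding closed_curve_in_def by (auto simp: S_eq)
qed

section \<open>Germs\<close>

lemma mem_germ: "f \<in> germ f" by (simp add: germ_def)

lemma germ_eq_iff: "germ f = germ g \<longleftrightarrow> (\<forall>\<^sub>F x in nhds 0. f x = g x)"
proof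
  assume "germ f = germ g"
  then have "f \<in> germ g" using mem_germ by blast
  then show "\<forall>\<^sub>F x in nhds 0. f x = g x" by (simp add: germ_def)
next
  assume fg: "\<forall>\<^sub>F x in nhds 0. f x = g x"
  show "germ f = germ g" unfolding germ_def
    by (intro Collect_cong eventually_subst; use fg in eventually_elim) simp
qed

text \<open>As \<open>g x\<close> tends to 0, another representative of the germ of \<open>f\<close>
  agrees with \<open>f\<close> at \<open>g x\<close> too.\<close>

lemma germ_comp_germ:
  assumes "(g \<longlongrightarrow> 0) (nhds 0)"
  shows "germ_comp (germ f) (germ g) = germ (f \<circ> g)"
proof (rule equalityI; rule subsetI)
  fix h assume "h \<in> germ_comp (germ f) (germ g)"
  then obtain f' g' where f': "\<forall>\<^sub>F x in nhds 0. f' x = f x" and g': "\<forall>\<^sub>F x in nhds 0. g' x = g x"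
    and h: "\<forall>\<^sub>F x in nhds 0. h x = f' (g' x)"
    by (auto simp: germ_comp_def germ_def)
  have "\<forall>\<^sub>F x in nhds 0. f' (g x) = f (g x)"
    using assms f' by (rule filterlim_iff[THEN iffD1, rule_format])
  with g' h show "h \<in> germ (f \<circ> g)" unfolding germ_def mem_Collect_eq
    by eventually_elim auto
next
  fix h assume "h \<in> germ (f \<circ> g)"
  then show "h \<in> germ_comp (germ f) (germ g)" unfolding germ_comp_def germ_def[of "f \<circ> g"]
    using mem_germ[of f] mem_germ[of g] by auto
qed

lemma tendsto_matrix_vector_mult_0: "((*v) (A :: real^'n^'m) \<longlongrightarrow> 0) (nhds 0)"
proof -
  have "isCont ((*v) A) 0" by (intro linear_continuous_at matrix_vector_mul_bounded_linear)
  then show ?thesis using tendsto_at_iff_tendsto_nhds[of "(*v) A" 0] by (simp add: isCont_def)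
qed

lemma germ_matrix_mult: "germ_comp (germ ((*v) A)) (germ ((*v) B)) = germ ((*v) (A ** B))"
  by (simp add: germ_comp_germ[OF tendsto_matrix_vector_mult_0] o_def matrix_vector_mul_assoc)

lemma GL2_subgroup: "subgroup GL2 Diff_omega"
proof
  have *: "germ ((*v) A) \<in> carrier Diff_omega" if "invertible A" for A :: "real^2^2"
  proof -
    have "real_analytic_on ((*v) A) UNIV"
      by (intro polynomial_map_real_analytic real_polynomial_function.intros(1)
          bounded_linear_compose[OF bounded_linear_vec_nth matrix_vector_mul_bounded_linear])
    moreover have "jacobian ((*v) A) (at 0) = A"
      using frechet_derivative_at[OF bounded_linear_imp_has_derivative[OF matrix_vector_mul_bounded_linear[of A]], of 0]
      by (simp add: jacobian_def flip: \<open>(*v) A = frechet_derivative ((*v) A) (at 0)\<close>)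
    ultimately show ?thesis using that unfolding Diff_omega_def
      by (auto simp: invertible_det_nz intro!: exI[of _ "(*v) A"] exI[of _ UNIV])
  qed
  show "GL2 \<subseteq> carrier Diff_omega" using * by (auto simp: GL2_def)
  show "x \<otimes>\<^bsub>Diff_omega\<^esub> y \<in> GL2" if "x \<in> GL2" "y \<in> GL2" for x y
    using that by (auto simp: GL2_def Diff_omega_def germ_matrix_mult invertible_mult)
  have one: "\<one>\<^bsub>Diff_omega\<^esub> = germ ((*v) (mat 1))"
  proof -
    have "(*v) (mat 1 :: real^2^2) = id" by (simp add: fun_eq_iff)
    then show ?thesis by (simp add: Diff_omega_def)
  qed
  then show "\<one>\<^bsub>Diff_omega\<^esub> \<in> GL2" by (auto simp: GL2_def invertible_def intro!: exI[of _ "mat 1"])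
  show "inv\<^bsub>Diff_omega\<^esub> x \<in> GL2" if "x \<in> GL2" for x
  proof -
    obtain A :: "real^2^2" where A: "invertible A" "x = germ ((*v) A)" using \<open>x \<in> GL2\<close> by (auto simp: GL2_def)
    obtain B where B: "A ** B = mat 1" "B ** A = mat 1" using A by (auto simp: invertible_def)
    then have iB: "invertible B" by (auto simp: invertible_def)
    have "inv\<^bsub>Diff_omega\<^esub> x = germ ((*v) B)"
      \<comment> \<open>The inverse is a definite description, so uniqueness must be shown: a left
        inverse \<open>f\<close> of \<open>A\<close> satisfies
        \<open>f (A *v (B *v x)) = B *v x\<close> near 0, hence has the germ of
        \<open>B\<close>.\<close>
      unfolding m_inv_def
    proof (rule the_equality)
      show "germ ((*v) B) \<in> carrier Diff_omega \<and> x \<otimes>\<^bsub>Diff_omega\<^esub> germ ((*v) B) = \<one>\<^bsub>Diff_omega\<^esub> \<and>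
          germ ((*v) B) \<otimes>\<^bsub>Diff_omega\<^esub> x = \<one>\<^bsub>Diff_omega\<^esub>"
        using *[OF iB] B by (simp add: one A(2)) (simp add: Diff_omega_def germ_matrix_mult)
    next
      fix y assume y: "y \<in> carrier Diff_omega \<and> x \<otimes>\<^bsub>Diff_omega\<^esub> y = \<one>\<^bsub>Diff_omega\<^esub> \<and>
          y \<otimes>\<^bsub>Diff_omega\<^esub> x = \<one>\<^bsub>Diff_omega\<^esub>"
      then obtain f where f: "y = germ f" by (auto simp: Diff_omega_def)
      have "germ (f \<circ> (*v) A) = germ id"
        using y by (simp add: Diff_omega_def A f germ_comp_germ[OF tendsto_matrix_vector_mult_0])
      then have "\<forall>\<^sub>F x in nhds 0. f (A *v x) = x" by (simp add: germ_eq_iff)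
      then have "\<forall>\<^sub>F x in nhds 0. f (A *v (B *v x)) = B *v x"
        using tendsto_matrix_vector_mult_0[of B, unfolded filterlim_iff] by blast
      then show "y = germ ((*v) B)" by (simp add: f germ_eq_iff matrix_vector_mul_assoc B)
    qed
    then show ?thesis using iB by (auto simp: GL2_def)
  qed
qed

section \<open>Invariant curves of linear maps\<close>

text \<open>Coordinates adapted to the tangent vector \<open>v\<close> bring \<open>A\<close> to the
  triangular form of \<open>tangent_curve_dynamics\<close>.\<close>

lemma invertible_linear_invariant_curve:
  fixes A :: "real^2^2"
  assumes A: "invertible A" and A2: "A ** A \<noteq> mat 1" and S: "smooth_curve_around_0 S"
    and inv: "\<forall>\<^sub>F p in nhds 0. p \<in> S \<longrightarrow> A *v p \<in> S"
  shows "\<exists>U. open U \<and> 0 \<in> U \<and> closed_curve_in real_analytic_on U (S \<inter> U) \<and> real_algebraic_in U (S \<inter> U)"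
proof -
  obtain N c \<tau> \<epsilon> v where "parametrized_curve S N c \<tau> \<epsilon> v"
    using smooth_curve_parametrization[OF S] .
  then interpret parametrized_curve S N c \<tau> \<epsilon> v .
  obtain B where AB: "A ** B = mat 1" and BA: "B ** A = mat 1" using A by (auto simp: invertible_def)
  have ABp: "A *v (B *v p) = p" and BAp: "B *v (A *v p) = p" for p
    by (simp_all add: matrix_vector_mul_assoc AB BA)
  have blA: "bounded_linear ((*v) A)" by (rule matrix_vector_mul_bounded_linear)
  \<comment> \<open>\<open>\<eta> p\<close> is the determinant of \<open>v\<close> and
    \<open>p\<close>, and \<open>w\<close> is \<open>v\<close> turned by a right angle. Dividing
    \<open>v\<close> and \<open>w\<close> by \<open>v \<bullet> v\<close> gives the basis dual to
    \<open>\<xi>0\<close> and \<open>\<eta>\<close>.\<close>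
  define \<xi>0 :: "real^2 \<Rightarrow> real" where "\<xi>0 = (\<lambda>p. v \<bullet> p)"
  define \<eta> :: "real^2 \<Rightarrow> real" where "\<eta> = (\<lambda>p. v$1 * p$2 - v$2 * p$1)"
  define w where "w = (vector [- (v$2), v$1] :: real^2)"
  define e where "e = v /\<^sub>R (v \<bullet> v)"
  define f where "f = w /\<^sub>R (v \<bullet> v)"
  have vv: "v \<bullet> v > 0" using v(1) by simp
  have bl0: "bounded_linear \<xi>0" unfolding \<xi>0_def by (rule bounded_linear_inner_right)
  have bl_nth: "bounded_linear (\<lambda>p::real^2. p $ i)" for i by (rule bounded_linear_vec_nth)
  have bl\<eta>: "bounded_linear \<eta>" unfolding \<eta>_def
    by (intro bounded_linear_sub bounded_linear_const_mult bl_nth)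
  interpret \<xi>0: bounded_linear \<xi>0 by (rule bl0)
  interpret \<eta>: bounded_linear \<eta> by (rule bl\<eta>)
  have \<xi>0v: "\<xi>0 v \<noteq> 0" using vv by (simp add: \<xi>0_def)
  have \<eta>v: "\<eta> v = 0" by (simp add: \<eta>_def)
  have inner2: "x \<bullet> y = x$1 * y$1 + x$2 * y$2" for x y :: "real^2"
    by (simp add: inner_vec_def sum_2)
  have coord0: "\<xi>0 p *\<^sub>R e + \<eta> p *\<^sub>R f = p" for p
  proof -
    have "\<xi>0 p *\<^sub>R v + \<eta> p *\<^sub>R w = (v \<bullet> v) *\<^sub>R p"
      by (simp add: vec_eq_iff forall_2 \<xi>0_def \<eta>_def w_def inner2 algebra_simps)
    then have "(\<xi>0 p *\<^sub>R v + \<eta> p *\<^sub>R w) /\<^sub>R (v \<bullet> v) = p" using vv by simp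
    then show ?thesis by (simp add: e_def f_def scaleR_add_right mult.commute)
  qed
  have dual0: "\<xi>0 e = 1" "\<eta> e = 0" "\<xi>0 f = 0" "\<eta> f = 1"
  proof -
    have "\<xi>0 w = 0" "\<eta> w = v \<bullet> v" by (simp_all add: \<xi>0_def \<eta>_def w_def inner2)
    then show "\<xi>0 e = 1" "\<eta> e = 0" "\<xi>0 f = 0" "\<eta> f = 1"
      using vv \<eta>v by (simp_all add: e_def f_def \<xi>0.scale \<eta>.scale) (simp add: \<xi>0_def)
  qed
  obtain M0 where M0: "\<forall>\<^sub>F p in nhds 0. p \<in> S \<longrightarrow> \<bar>\<eta> p\<bar> \<le> M0 * \<bar>\<xi>0 p\<bar> ^ 2"
    using \<eta>_quadratic[OF bl0 \<xi>0v bl\<eta> \<eta>v] by blast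
  have "\<forall>\<^sub>F p in nhds 0. p \<in> S \<longrightarrow> \<bar>\<eta> p\<bar> \<le> (\<bar>M0\<bar> * norm v ^ 2) * norm p ^ 2"
    using M0
  proof eventually_elim
    case (elim p)
    have "\<bar>\<xi>0 p\<bar> \<le> norm v * norm p" unfolding \<xi>0_def by (rule Cauchy_Schwarz_ineq2)
    then have "M0 * \<bar>\<xi>0 p\<bar> ^ 2 \<le> \<bar>M0\<bar> * (norm v * norm p) ^ 2"
      by (intro mult_mono power_mono) auto
    then show ?case using elim by (simp only: power_mult_distrib mult.assoc) linarith
  qed
  \<comment> \<open>In the plane this means that \<open>A *v v\<close> is a multiple of
    \<open>v\<close>.\<close>
  from tangent_line_invariant[OF blA inv this bl\<eta>] have \<eta>Av: "\<eta> (A *v v) = 0" .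
  define a where "a = \<xi>0 (A *v v) / (v \<bullet> v)"
  have Av: "A *v v = a *\<^sub>R v"
    using coord0[of "A *v v"] by (simp add: \<eta>Av e_def a_def divide_inverse)
  have a: "a \<noteq> 0"
  proof
    assume "a = 0"
    then have "A *v v = 0" by (simp add: Av)
    then have "v = 0" using BAp[of v] by simp
    then show False using v(1) by simp
  qed
  \<comment> \<open>The second eigenvalue. Since \<open>v\<close> is \<open>A *v v\<close> divided
    by \<open>a\<close>, the determinant of \<open>v\<close> and \<open>A *v p\<close> is
    \<open>det A / a\<close> times that of \<open>v\<close> and \<open>p\<close>.\<close>
  define d where "d = det A / a"
  have d: "d \<noteq> 0" using a A by (simp add: d_def invertible_det_nz)
  have Av_nth: "a * v $ i = A $ i $ 1 * v $ 1 + A $ i $ 2 * v $ 2" for i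
    using arg_cong[OF Av, of "\<lambda>x. x $ i"] by (simp add: matrix_vector_mult_def sum_2)
  have \<eta>A: "\<eta> (A *v p) = d * \<eta> p" for p
  proof -
    have "a * \<eta> (A *v p) = (a * v $ 1) * (A *v p) $ 2 - (a * v $ 2) * (A *v p) $ 1"
      by (simp add: \<eta>_def algebra_simps)
    also have "\<dots> = det A * \<eta> p"
      unfolding Av_nth by (simp add: matrix_vector_mult_def sum_2 det_2 \<eta>_def algebra_simps)
    finally show ?thesis using a by (simp add: d_def field_simps)
  qed
  define b0 where "b0 = \<xi>0 (A *v f)"
  have \<xi>0A: "\<xi>0 (A *v p) = a * \<xi>0 p + b0 * \<eta> p" for p
  proof -
    have "A *v p = \<xi>0 p *\<^sub>R (A *v e) + \<eta> p *\<^sub>R (A *v f)"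
      using arg_cong[OF coord0[of p], of "(*v) A"] by (simp add: matrix_vector_right_distrib matrix_vector_mult_scaleR)
    moreover have "A *v e = a *\<^sub>R e" by (simp add: e_def matrix_vector_mult_scaleR Av mult.commute)
    ultimately show ?thesis by (simp add: \<xi>0.add \<xi>0.scale dual0 b0_def)
  qed
  \<comment> \<open>Replacing \<open>\<xi>0\<close> by \<open>\<xi>0 p + s * \<eta> p\<close>
    changes the off-diagonal entry to \<open>b0 - s * (a - d)\<close>, which this \<open>s\<close>
    annihilates when \<open>a \<noteq> d\<close>.\<close>
  define s where "s = (if a = d then 0 else b0 / (a - d))"
  define b where "b = b0 - s * (a - d)"
  define \<xi> where "\<xi> = (\<lambda>p. \<xi>0 p + s * \<eta> p)"
  define g where "g = f - s *\<^sub>R e"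
  have diag: "b = 0" if "a \<noteq> d" using that by (simp add: b_def s_def)
  have bl\<xi>: "bounded_linear \<xi>" unfolding \<xi>_def
    by (intro bounded_linear_add bounded_linear_const_mult bl0 bl\<eta>)
  have \<xi>v: "\<xi> v \<noteq> 0" by (simp add: \<xi>_def \<eta>v \<xi>0v)
  have coord: "p = \<xi> p *\<^sub>R e + \<eta> p *\<^sub>R g" for p
  proof -
    have "\<xi> p *\<^sub>R e + \<eta> p *\<^sub>R g = \<xi>0 p *\<^sub>R e + \<eta> p *\<^sub>R f"
      by (simp add: \<xi>_def g_def algebra_simps)
    then show ?thesis by (simp add: coord0)
  qed
  have dual: "\<xi> e = 1" "\<eta> e = 0" "\<xi> g = 0" "\<eta> g = 1"
    by (simp_all add: \<xi>_def g_def dual0 \<xi>0.diff \<xi>0.scale \<eta>.diff \<eta>.scale)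
  have \<xi>A: "\<xi> (A *v p) = a * \<xi> p + b * \<eta> p" for p
    by (simp add: \<xi>_def \<xi>0A \<eta>A b_def algebra_simps)
  have \<eta>B: "\<eta> (B *v p) = \<eta> p / d" for p
    using \<eta>A[of "B *v p"] d by (simp add: ABp)
  have \<xi>B: "\<xi> (B *v p) = (\<xi> p - b / d * \<eta> p) / a" for p
    using \<xi>A[of "B *v p"] a by (simp add: ABp \<eta>B field_simps)
  have eqI: "p = q" if "\<xi> p = \<xi> q" "\<eta> p = \<eta> q" for p q
    using coord[of p] coord[of q] that by metis
  have not_involutive: "a ^ 2 \<noteq> 1 \<or> d ^ 2 \<noteq> 1 \<or> b * (a + d) \<noteq> 0"
  proof (rule ccontr)
    assume "\<not> ?thesis"
    then have *: "a * a = 1" "d * d = 1" "a * b + b * d = 0" by (auto simp: power2_eq_square algebra_simps)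
    have "A *v (A *v p) = p" for p
    proof (rule eqI)
      have "\<xi> (A *v (A *v p)) = (a * a) * \<xi> p + (a * b + b * d) * \<eta> p"
        by (simp add: \<xi>A \<eta>A algebra_simps)
      then show "\<xi> (A *v (A *v p)) = \<xi> p" by (simp add: *)
      have "\<eta> (A *v (A *v p)) = (d * d) * \<eta> p" by (simp add: \<eta>A)
      then show "\<eta> (A *v (A *v p)) = \<eta> p" by (simp add: *)
    qed
    then have "A ** A = mat 1" by (simp add: matrix_eq matrix_vector_mul_assoc)
    then show False using A2 by simp
  qed
  obtain K where K: "\<forall>\<^sub>F p in nhds 0. p \<in> S \<longrightarrow> norm p \<le> K * \<bar>\<xi> p\<bar>"
    using norm_le_\<xi>[OF bl\<xi> \<xi>v] by blast
  obtain M where M: "\<forall>\<^sub>F p in nhds 0. p \<in> S \<longrightarrow> \<bar>\<eta> p\<bar> \<le> M * \<bar>\<xi> p\<bar> ^ 2"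
    using \<eta>_quadratic[OF bl\<xi> \<xi>v bl\<eta> \<eta>v] by blast
  have tendsto_\<xi>: "(\<xi> \<longlongrightarrow> 0) (nhds 0)"
  proof -
    have "isCont \<xi> 0" by (rule linear_continuous_at[OF bl\<xi>])
    then show ?thesis
      using tendsto_at_iff_tendsto_nhds[of \<xi> 0] by (simp add: isCont_def \<xi>_def \<xi>0.zero \<eta>.zero)
  qed
  interpret tangent_curve_dynamics S "(*v) A" "(*v) B" \<xi> \<eta> a b d K M
    by unfold_locales
      (fact tendsto_matrix_vector_mult_0 tendsto_\<xi> inv inverse_invariant[OF blA BAp inv] a d diag
        \<xi>A \<eta>A \<xi>B \<eta>B K M frequently_\<xi>_nonzero[OF bl\<xi> \<xi>v] flat_or_finite_order[OF bl\<xi> \<xi>v bl\<eta> \<eta>v])+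
  obtain \<alpha> k where mono: "\<forall>\<^sub>F p in nhds 0. p \<in> S \<longrightarrow> \<eta> p = \<alpha> * \<xi> p ^ k"
    using curve_is_monomial[OF not_involutive] by blast
  have "\<forall>\<^sub>F q in nhds 0. \<exists>p\<in>S. (p \<in> S \<longrightarrow> \<eta> p = \<alpha> * \<xi> p ^ k) \<and> \<xi> p = \<xi> q"
    using tendsto_\<xi> \<xi>_locally_onto[OF bl\<xi> \<xi>v mono] unfolding filterlim_iff by blast
  \<comment> \<open>For the converse inclusion, a point \<open>q\<close> of the monomial curve near
    0 shares its \<open>\<xi>\<close>-value with some \<open>p\<close> in \<open>S\<close>; the
    equation forces equal \<open>\<eta>\<close>-values, so \<open>p = q\<close>.\<close>
  with mono have "\<forall>\<^sub>F q in nhds 0. q \<in> S \<longleftrightarrow> \<eta> q = \<alpha> * \<xi> q ^ k"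
  proof eventually_elim
    case (elim q)
    then obtain p where "p \<in> S" "\<eta> p = \<alpha> * \<xi> q ^ k" "\<xi> p = \<xi> q" by auto
    then show ?case using elim(1) eqI[of p q] by auto
  qed
  then obtain U where U: "open U" "0 \<in> U" "\<And>q. q \<in> U \<Longrightarrow> q \<in> S \<longleftrightarrow> \<eta> q = \<alpha> * \<xi> q ^ k"
    by (auto simp: eventually_nhds)
  then have "S \<inter> U = {q \<in> U. \<eta> q = \<alpha> * \<xi> q ^ k}" by auto
  from monomial_curve_analytic_algebraic[OF bl\<xi> bl\<eta> coord dual U(1) this] U
  show ?thesis by blast
qed

lemma invariant_curve_germ_iff:
  "invariant_curve (germ f) S \<longleftrightarrow> (\<forall>\<^sub>F q in nhds 0. q \<in> S \<longrightarrow> f q \<in> S)"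
proof
  assume "invariant_curve (germ f) S"
  then obtain h where "\<forall>\<^sub>F q in nhds 0. h q = f q" "\<forall>\<^sub>F q in nhds 0. q \<in> S \<longrightarrow> h q \<in> S"
    by (auto simp: invariant_curve_def germ_def)
  then show "\<forall>\<^sub>F q in nhds 0. q \<in> S \<longrightarrow> f q \<in> S" by eventually_elim auto
qed (auto simp: invariant_curve_def intro: mem_germ)

theorem lemma1p8:
  shows "ICP GL2 \<and>
    (\<forall>(A :: real^2^2) \<gamma>.
       invertible A \<and> A ** A \<noteq> mat 1 \<and>
       smooth_curve_around_0 \<gamma> \<and> invariant_curve (germ ((*v) A)) \<gamma> \<longrightarrow>
       (\<exists>U. open U \<and> 0 \<in> U \<and>
          closed_curve_in real_analytic_on U (\<gamma> \<inter> U) \<and> real_algebraic_in U (\<gamma> \<inter> U)))"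
proof -
  have main: "\<exists>U. open U \<and> 0 \<in> U \<and> closed_curve_in real_analytic_on U (\<gamma> \<inter> U) \<and> real_algebraic_in U (\<gamma> \<inter> U)"
    if "invertible A" "A ** A \<noteq> mat 1" "smooth_curve_around_0 \<gamma>" "invariant_curve (germ ((*v) A)) \<gamma>"
    for A :: "real^2^2" and \<gamma>
    using that by (intro invertible_linear_invariant_curve) (auto simp: invariant_curve_germ_iff)
  have "ICP GL2"
    unfolding ICP_def
  proof (intro conjI ballI impI allI GL2_subgroup)
    fix g S assume g: "g \<in> GL2" "g \<otimes>\<^bsub>Diff_omega\<^esub> g \<noteq> \<one>\<^bsub>Diff_omega\<^esub>"
      and S: "smooth_curve_around_0 S \<and> invariant_curve g S"
    obtain A :: "real^2^2" where A: "invertible A" "g = germ ((*v) A)"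
      using g(1) by (auto simp: GL2_def)
    have "germ ((*v) (A ** A)) \<noteq> germ id"
      using g(2) by (simp add: Diff_omega_def A(2) germ_matrix_mult)
    moreover have "(*v) (mat 1 :: real^2^2) = id" by (simp add: fun_eq_iff)
    ultimately have "A ** A \<noteq> mat 1" by metis
    then obtain W where W: "open W" "0 \<in> W" "closed_curve_in real_analytic_on W (S \<inter> W)"
      using main[OF A(1)] S A(2) by blast
    then show "\<exists>W. open W \<and> 0 \<in> W \<and>
        (\<forall>p \<in> S \<inter> W - {0}. \<exists>U. p \<in> U \<and> closed_curve_in real_analytic_on U (S \<inter> U))"
      \<comment> \<open>For \<open>p\<close> in \<open>S \<inter> W\<close> the set \<open>W\<close>
        itself serves as its neighbourhood.\<close>
      by (intro exI[of _ W]) auto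
  qed
  with main show ?thesis by blast
qed

end
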